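(* Let $G$ be a compact group. Then every dense subgroup of $G$ has the Arhangel'skiĭ property if and only if the weight $w(G)$ is a strong limit cardinal.
   Context: All spaces and topological groups are assumed to be Hausdorff. Compact groups are not assumed to be abelian. $w(X)$ denotes the weight of a space $X$. A space $X$ has the Arhangel'skiĭ property if $w(X)\le |X|$. Subgroups carry the subspace topology. A cardinal $\tau$ is strong limit if $2^\sigma<\tau$ for every cardinal $\sigma<\tau$.
   Formalization: The compact group G is assumed to be infinite; for every finite group the equivalence fails, since its only dense subgroup is itself with w(G) = |G|, while a nonzero finite cardinal is never strong limit. *)

theory Defs
  imports "HOL-Analysis.Analysis" "HOL-Algebra.Group"
begin

unbundle cardinal_syntax

section \<open>Compact topological groups\<close>

locale topological_group = group G
  for G :: "('a, 'b) monoid_scheme" (structure) and T :: "'a topology" +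
  assumes topspace_eq_carrier: "topspace T = carrier G"
    and continuous_mult: "continuous_map (prod_topology T T) T (\<lambda>(x, y). x \<otimes> y)"
    and continuous_inv: "continuous_map T T (\<lambda>x. inv x)"
    and Hausdorff: "Hausdorff_space T"

locale compact_group = topological_group +
  assumes compact: "compact_space T"

definition dense_subgroup :: "'a set \<Rightarrow> ('a, 'b) monoid_scheme \<Rightarrow> 'a topology \<Rightarrow> bool" where
  "dense_subgroup H G T \<longleftrightarrow> subgroup H G \<and> T closure_of H = topspace T"

section \<open>Weight and the Arhangel'skii property\<close>

text \<open>Cardinals are represented by the cardinal orders of the HOL library, compared
  by \<open>\<le>o\<close> and \<open><o\<close>. The sense of base is the one used in \<^const>\<open>second_countable\<close>.\<close>

definition base_of :: "'a topology \<Rightarrow> 'a set set \<Rightarrow> bool" where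
  "base_of X \<B> \<longleftrightarrow> (\<forall>V \<in> \<B>. openin X V) \<and>
     (\<forall>U x. openin X U \<and> x \<in> U \<longrightarrow> (\<exists>V \<in> \<B>. x \<in> V \<and> V \<subseteq> U))"

text \<open>No \<open>+ \<aleph>\<^sub>0\<close> is built in: a finite discrete space has its number of points as weight.\<close>

definition weight :: "'a topology \<Rightarrow> 'a set rel" where
  "weight X = (SOME r. \<exists>\<B>. base_of X \<B> \<and> r = |\<B>| \<and> (\<forall>\<B>'. base_of X \<B>' \<longrightarrow> |\<B>| \<le>o |\<B>'| ))"

lemma weight_attained:
  "\<exists>\<B>. base_of X \<B> \<and> weight X = |\<B>| \<and> (\<forall>\<B>'. base_of X \<B>' \<longrightarrow> |\<B>| \<le>o |\<B>'| )"
proof -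
  have "base_of X {U. openin X U}"
    unfolding base_of_def by blast
  then have "\<exists>r \<in> {|\<B>| | \<B>. base_of X \<B>}. \<forall>r' \<in> {|\<B>| | \<B>. base_of X \<B>}. r \<le>o r'"
    by (intro exists_minim_Card_order) (auto simp: card_of_Card_order)
  then have "\<exists>r \<B>. base_of X \<B> \<and> r = |\<B>| \<and> (\<forall>\<B>'. base_of X \<B>' \<longrightarrow> |\<B>| \<le>o |\<B>'| )"
    by blast
  then show ?thesis
    unfolding weight_def by (rule someI_ex)
qed

lemma Card_order_weight: "Card_order (weight X)"
  using weight_attained[of X] by (metis card_of_Card_order)

lemma weight_le: "base_of X \<B> \<Longrightarrow> weight X \<le>o |\<B>|"
  using weight_attained[of X] by metis

definition Arhangelskii :: "'a topology \<Rightarrow> bool" where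
  "Arhangelskii X \<longleftrightarrow> weight X \<le>o |topspace X|"

section \<open>Strong limit cardinals\<close>

text \<open>HOL cannot quantify over cardinals on all types at once, but every cardinal below
  \<open>r\<close> is represented on the type underlying \<open>r\<close>; see \<open>strong_limitD\<close>.\<close>

definition strong_limit :: "'a rel \<Rightarrow> bool" where
  "strong_limit r \<longleftrightarrow> Card_order r \<and>
     (\<forall>s :: 'a rel. Card_order s \<and> s <o r \<longrightarrow> ctwo ^c s <o r)"

lemma strong_limitD:
  fixes r :: "'a rel" and s :: "'c rel"
  assumes "strong_limit r" "Card_order s" "s <o r"
  shows "ctwo ^c s <o r"
proof -
  obtain p :: "'a rel" where p: "s =o p" "p <o r"
    using assms(3) internalize_ordLess[of s r] by blast
  have "Card_order p"
    using Card_order_ordIso2[OF assms(2) p(1)] .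
  then have "ctwo ^c p <o r"
    using assms(1) p(2) unfolding strong_limit_def by blast
  moreover have "ctwo ^c s =o ctwo ^c p"
    by (rule cexp_cong2[OF p(1) Card_order_ctwo assms(2)])
  ultimately show ?thesis
    using ordIso_ordLess_trans by blast
qed

text \<open>A nonzero finite cardinal \<open>n\<close> is never a strong limit, since \<open>n \<le> 2 ^ (n - 1)\<close>.\<close>

lemma finite_card_of_ordLess:
  assumes "finite A" "finite B"
  shows "|A| <o |B| \<longleftrightarrow> card A < card B"
  using card_of_ordLess[of B A] inj_on_iff_card_le[OF assms(2,1)] by auto

lemma strong_limit_infinite:
  assumes "strong_limit r" "Field r \<noteq> {}"
  shows "infinite (Field r)"
proof
  assume fin: "finite (Field r)"
  have r: "|Field r| =o r"
    using assms(1) card_of_Field_ordIso unfolding strong_limit_def by blast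
  obtain a where a: "a \<in> Field r"
    using assms(2) by blast
  define A where "A = Field r - {a}"
  have finA: "finite A"
    using fin A_def by simp
  have cardA: "card (Field r) = Suc (card A)"
    using fin a unfolding A_def by (rule card.remove)
  have "|A| <o |Field r|"
    using finA fin cardA by (simp add: finite_card_of_ordLess)
  then have "|A| <o r"
    using r ordLess_ordIso_trans by blast
  then have "ctwo ^c |A| <o r"
    using strong_limitD[OF assms(1) card_of_Card_order] by blast
  moreover have "|Pow A| =o ctwo ^c |A|"
    unfolding ctwo_def cexp_def Field_card_of by (rule card_of_Pow_Func)
  ultimately have "|Pow A| <o |Field r|"
    using r ordIso_ordLess_trans ordLess_ordIso_trans ordIso_symmetric by blast
  then have "2 ^ card A < Suc (card A)"
    using finA fin cardA by (simp add: finite_card_of_ordLess card_Pow)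
  then show False
    using less_exp[of "card A"] by linarith
qed

end

(* If H is dense in G, then by regularity the interiors of the closures of subsets of H form a base,
   so w(G) <= 2^|H|; for a strong limit weight this forces w(G) <= |H|. Conversely, let
   s < w(G) <= 2^s. It suffices to find a dense set of size s: it generates a dense subgroup H of
   size s, and a base of H yields a base of G by left translating by H the interiors of closures, so
   w(G) <= max(|H|, w(H)). The dense set is the image of one in a product of 2^s finite discrete
   spaces under a continuous surjection onto G. To obtain this surjection, choose for each member of
   a base at 1 a closed G_delta subgroup inside it, and lift a parametrisation of the left cosets of
   the intersection of some of these subgroups to one further subgroup at a time, by a
   zero-dimensional selection theorem; Zorn's lemma replaces the transfinite recursion. *)

theory Submission
  imports Defs "HOL-Algebra.Generated_Groups"
begin

text \<open>Compact Hausdorff spaces need not be images of products of finite spaces, so the group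
  structure has to enter; that compact groups are such images is the theorem of Ivanovskii and
  Kuz'minov. The subgroups need not be normal, and only their left cosets are used. A map to a
  varying coset space is encoded as a closed relation between parameters and
  \<open>carrier G\<close> whose fibres are cosets: all stages then share one type, a limit is an
  intersection, and compactness keeps it total and onto. The obstacle in a single step is
  surjectivity, since an arbitrary lift need not reach every finer coset. Each subgroup therefore
  has its own countable block of finite coordinates, and the lift is prescribed wherever that block
  is a coherent sequence of centres; as the earlier map ignores the block, every element is reached.
  A stage over \<open>A\<close> is closed for the topology that sees only the coordinates over
  \<open>A\<close>, which is how this independence survives limits.\<close>

section \<open>Cardinals of finite sequences\<close>

lemma card_of_Times_ordLeq_infinite:
  assumes "infinite C" "|A| \<le>o |C|" "|B| \<le>o |C|"
  shows "|A \<times> B| \<le>o |C|"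
  using assms by (intro card_of_Sigma_ordLeq_infinite) auto

lemma card_of_image_ordLeq: "|A| \<le>o r \<Longrightarrow> |f ` A| \<le>o r"
  using card_of_image ordLeq_transitive by blast

lemma card_of_nat_ordLeq: "infinite S \<Longrightarrow> |UNIV :: nat set| \<le>o |S|"
  using infinite_iff_card_of_nat by blast

lemma card_of_lists_ordLeq:
  assumes S: "infinite S" and A: "|A| \<le>o |S|"
  shows "|lists A| \<le>o |S|"
proof -
  have "|{xs \<in> lists A. length xs = n}| \<le>o |S|" for n
  proof (induction n)
    case 0
    have "{xs \<in> lists A. length xs = 0} = {[]}" by auto
    moreover have "S \<noteq> {}" using S by auto
    ultimately show ?case
      by (simp add: card_of_singl_ordLeq)
  next
    case (Suc n)
    have "{xs \<in> lists A. length xs = Suc n} = (\<lambda>(x, xs). x # xs) ` (A \<times> {xs \<in> lists A. length xs = n})"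
      by (auto simp: length_Suc_conv image_iff)
    then show ?case
      using card_of_image_ordLeq[OF card_of_Times_ordLeq_infinite[OF S A Suc.IH]] by simp
  qed
  moreover have "lists A = (\<Union>n. {xs \<in> lists A. length xs = n})" by auto
  ultimately show ?thesis
    using card_of_UNION_ordLeq_infinite[OF S card_of_nat_ordLeq[OF S], of "\<lambda>n. {xs \<in> lists A. length xs = n}"] by simp
qed

lemma card_of_finite_subsets_ordLeq:
  assumes "infinite S"
  shows "|{E. finite E \<and> E \<subseteq> S}| \<le>o |S|"
proof -
  have "{E. finite E \<and> E \<subseteq> S} \<subseteq> set ` lists S"
    using finite_list by (fastforce simp: lists_eq_set)
  then have "|{E. finite E \<and> E \<subseteq> S}| \<le>o |set ` lists S|"
    by (rule card_of_mono1)
  also have "|set ` lists S| \<le>o |S|"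
    by (rule card_of_image_ordLeq[OF card_of_lists_ordLeq[OF assms card_of_mono1[OF subset_refl]]])
  finally show ?thesis .
qed

text \<open>Every element of the generated subgroup is the product of a word in \<open>D\<close> and
  the inverses of its elements, and there are at most \<open>|S|\<close> such words.\<close>

lemma (in group) card_of_generate_ordLeq:
  assumes S: "infinite S" and D: "D \<subseteq> carrier G" "|D| \<le>o |S|"
  shows "|generate G D| \<le>o |S|"
proof -
  let ?A = "D \<union> m_inv G ` D"
  let ?prod = "\<lambda>xs. foldr (\<otimes>) xs \<one>"
  have A: "?A \<subseteq> carrier G" using D(1) by auto
  have closed: "?prod xs \<in> carrier G" if "set xs \<subseteq> ?A" for xs
    using that A by (induction xs) auto
  have append: "?prod (xs @ ys) = ?prod xs \<otimes> ?prod ys" if "set xs \<subseteq> ?A" "set ys \<subseteq> ?A" for xs ys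
    using that(1)
  proof (induction xs)
    case (Cons x xs)
    then have "x \<in> carrier G" using A by auto
    with Cons show ?case
      using closed[of xs] closed[OF that(2)] by (simp add: m_assoc)
  qed (simp add: closed[OF that(2)])
  have "g \<in> ?prod ` lists ?A" if "g \<in> generate G D" for g
    using that
  proof (induction rule: generate.induct)
    case one
    show ?case by (intro image_eqI[of _ _ "[]"]) auto
  next
    case (incl h)
    then show ?case using D(1) by (intro image_eqI[of _ _ "[h]"]) auto
  next
    case (inv h)
    then show ?case using D(1) by (intro image_eqI[of _ _ "[inv h]"]) auto
  next
    case (eng g h)
    then obtain xs ys where "g = ?prod xs" "h = ?prod ys" "xs \<in> lists ?A" "ys \<in> lists ?A" by blast
    then show ?case
      by (intro image_eqI[of _ _ "xs @ ys"]) (auto simp: append lists_eq_set simp del: foldr_append)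
  qed
  then have "|generate G D| \<le>o |?prod ` lists ?A|"
    by (intro card_of_mono1 subsetI)
  moreover have "|?A| \<le>o |S|"
    using D(2) S by (intro card_of_Un_ordLeq_infinite_Field card_of_image_ordLeq card_of_Card_order)
      (simp_all add: Field_card_of)
  ultimately show ?thesis
    using ordLeq_transitive[OF _ card_of_image_ordLeq[OF card_of_lists_ordLeq[OF S]]] by simp
qed

section \<open>Compact factors of products\<close>

text \<open>Upper semicontinuity of the fibres: the complement is the projection, along a compact
  factor and hence by a closed map, of the part of \<open>R\<close> outside
  \<open>W\<close>.\<close>

lemma openin_fibre_subset:
  assumes "compact_space Y" "closedin (prod_topology X Y) R" "openin Y W"
  shows "openin X {x \<in> topspace X. R `` {x} \<subseteq> W}"
proof -
  have R: "R \<subseteq> topspace X \<times> topspace Y"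
    using closedin_subset[OF assms(2)] by simp
  have "closedin (prod_topology X Y) (topspace X \<times> (topspace Y - W))"
    using assms(3) by (simp add: closedin_prod_Times_iff openin_closedin_eq)
  then have "closedin X (fst ` (R \<inter> topspace X \<times> (topspace Y - W)))"
    using closed_map_fst[OF assms(1)] assms(2) closedin_Int unfolding closed_map_def by blast
  moreover have "{x \<in> topspace X. R `` {x} \<subseteq> W} = topspace X - fst ` (R \<inter> topspace X \<times> (topspace Y - W))"
    using R by (force simp: image_iff)
  ultimately show ?thesis by (simp add: openin_diff)
qed

lemma closedin_fibre:
  assumes "closedin (prod_topology X Y) R" "x \<in> topspace X"
  shows "closedin Y (R `` {x})"
proof -
  have "continuous_map Y (prod_topology X Y) (\<lambda>y. (x, y))"
    using assms(2) by (simp add: continuous_map_pairwise o_def)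
  note closedin_continuous_map_preimage[OF this assms(1)]
  moreover have "{y \<in> topspace Y. (x, y) \<in> R} = R `` {x}"
    using closedin_subset[OF assms(1)] by auto
  ultimately show ?thesis by simp
qed

lemma closedin_cofibre:
  assumes "closedin (prod_topology X Y) R" "y \<in> topspace Y"
  shows "closedin X {x. (x, y) \<in> R}"
proof -
  have "continuous_map X (prod_topology X Y) (\<lambda>x. (x, y))"
    using assms(2) by (simp add: continuous_map_pairwise o_def)
  note closedin_continuous_map_preimage[OF this assms(1)]
  moreover have "{x \<in> topspace X. (x, y) \<in> R} = {x. (x, y) \<in> R}"
    using closedin_subset[OF assms(1)] by auto
  ultimately show ?thesis by simp
qed

text \<open>A finite nonempty subfamily of a chain contains its own intersection, which gives the
  finite intersection property. Serves the limit stages in Zorn's lemma.\<close>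

lemma compact_space_imp_chain_Inter:
  assumes "compact_space X" "\<And>C. C \<in> \<C> \<Longrightarrow> closedin X C" "{} \<notin> \<C>"
    and chain: "\<And>C D. C \<in> \<C> \<Longrightarrow> D \<in> \<C> \<Longrightarrow> C \<subseteq> D \<or> D \<subseteq> C"
  shows "\<Inter>\<C> \<noteq> {}"
proof -
  have "\<Inter>\<F> \<noteq> {}" if "finite \<F>" "\<F> \<subseteq> \<C>" for \<F>
  proof (cases "\<F> = {}")
    case False
    with that have "\<Inter>\<F> \<in> \<F>"
    proof (induction \<F> rule: finite_induct)
      case (insert C \<F>)
      show ?case
      proof (cases "\<F> = {}")
        case False
        then have "\<Inter>\<F> \<in> \<F>" using insert by simp
        then have "C \<subseteq> \<Inter>\<F> \<or> \<Inter>\<F> \<subseteq> C"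
          using insert.prems chain by blast
        then show ?thesis
          using \<open>\<Inter>\<F> \<in> \<F>\<close> by (metis Inter_insert inf.absorb1 inf.absorb2 insertCI)
      qed simp
    qed simp
    then show ?thesis using that assms(3) by (metis subsetD)
  qed simp
  then show ?thesis
    using assms(1)[unfolded compact_space_fip, THEN spec[of _ \<C>]] assms(2) by simp
qed

section \<open>Locally constant maps on zero-dimensional compact spaces\<close>

definition zero_dimensional :: "'a topology \<Rightarrow> bool" where
  "zero_dimensional X \<longleftrightarrow> (\<forall>U x. openin X U \<and> x \<in> U \<longrightarrow>
     (\<exists>K. openin X K \<and> closedin X K \<and> x \<in> K \<and> K \<subseteq> U))"

definition locally_constant :: "'a topology \<Rightarrow> ('a \<Rightarrow> 'b) \<Rightarrow> bool" where
  "locally_constant X c \<longleftrightarrow> (\<forall>Y. openin X {x \<in> topspace X. c x \<in> Y})"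

lemma locally_constantD: "locally_constant X c \<Longrightarrow> openin X {x \<in> topspace X. c x = v}"
  unfolding locally_constant_def by (drule spec[of _ "{v}"]) simp

text \<open>Clopen sets with a uniform witness cover the space; a finite subcover suffices, and
  overlaps are resolved by letting each newly added set override the earlier values.\<close>

lemma locally_constant_choice:
  assumes "compact_space X" "zero_dimensional X"
    and local: "\<And>x. x \<in> topspace X \<Longrightarrow> \<exists>v U. openin X U \<and> x \<in> U \<and> (\<forall>y \<in> U. \<Phi> y v)"
  obtains c where "locally_constant X c" "\<And>x. x \<in> topspace X \<Longrightarrow> \<Phi> x (c x)"
proof -
  let ?\<K> = "{K. openin X K \<and> closedin X K \<and> (\<exists>v. \<forall>y \<in> K. \<Phi> y v)}"
  have "topspace X \<subseteq> \<Union>?\<K>"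
  proof
    fix x assume "x \<in> topspace X"
    from local[OF this] obtain v U where U: "openin X U" "x \<in> U" "\<forall>y \<in> U. \<Phi> y v" by blast
    then obtain K where "openin X K" "closedin X K" "x \<in> K" "K \<subseteq> U"
      using assms(2) unfolding zero_dimensional_def by meson
    then show "x \<in> \<Union>?\<K>" using U(3) by blast
  qed
  then obtain \<F> where \<F>: "finite \<F>" "\<F> \<subseteq> ?\<K>" "topspace X \<subseteq> \<Union>\<F>"
    using assms(1) unfolding compact_space_alt by (metis (no_types, lifting) mem_Collect_eq)
  have "\<exists>c. (\<forall>Y. openin X {x \<in> \<Union>\<F>. c x \<in> Y}) \<and> (\<forall>x \<in> \<Union>\<F>. \<Phi> x (c x))"
    using \<F>(1,2)
  proof (induction rule: finite_induct)
    case (insert K \<F>)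
    then obtain c v where c: "\<forall>Y. openin X {x \<in> \<Union>\<F>. c x \<in> Y}" "\<forall>x \<in> \<Union>\<F>. \<Phi> x (c x)"
      and K: "openin X K" "closedin X K" "\<forall>x \<in> K. \<Phi> x v" by auto
    let ?c = "\<lambda>x. if x \<in> K then v else c x"
    have "openin X {x \<in> \<Union>(insert K \<F>). ?c x \<in> Y}" for Y
    proof -
      have "{x \<in> \<Union>(insert K \<F>). ?c x \<in> Y} = (if v \<in> Y then K else {}) \<union> ({x \<in> \<Union>\<F>. c x \<in> Y} - K)"
        by auto
      then show ?thesis using c(1) K(1,2) by (auto intro!: openin_Un openin_diff)
    qed
    moreover have "\<forall>x \<in> \<Union>(insert K \<F>). \<Phi> x (?c x)" using c(2) K(3) by auto
    ultimately show ?case by (intro exI[of _ ?c]) blast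
  qed simp
  moreover have "\<Union>\<F> = topspace X"
    using \<F>(2,3) openin_subset by blast
  ultimately show thesis
    using that unfolding locally_constant_def by auto
qed

section \<open>Shrinking sequences of neighbourhoods of the identity\<close>

lemma (in group) mult_inv_mult_cancel:
  "a \<in> carrier G \<Longrightarrow> x \<in> carrier G \<Longrightarrow> a \<otimes> (inv a \<otimes> x) = x"
  by (simp flip: m_assoc)

context topological_group
begin

lemma continuous_map_mult:
  assumes "continuous_map X T f" "continuous_map X T g"
  shows "continuous_map X T (\<lambda>x. f x \<otimes> g x)"
proof -
  have "continuous_map X (prod_topology T T) (\<lambda>x. (f x, g x))"
    using assms by (simp add: continuous_map_pairwise o_def)
  from continuous_map_compose[OF this continuous_mult] show ?thesis by (simp add: o_def)
qed

lemma openin_left_translate: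
  assumes "openin T W" "g \<in> carrier G"
  shows "openin T {x \<in> carrier G. inv g \<otimes> x \<in> W}"
proof -
  have "continuous_map T T (\<lambda>x. inv g \<otimes> x)"
    using assms(2) by (intro continuous_map_mult continuous_map_id[unfolded id_def])
      (simp add: topspace_eq_carrier)
  from openin_continuous_map_preimage[OF this assms(1)]
  show ?thesis by (simp add: topspace_eq_carrier)
qed

lemma openin_right_translate:
  assumes "openin T W" "g \<in> carrier G"
  shows "openin T {x \<in> carrier G. x \<otimes> inv g \<in> W}"
proof -
  have "continuous_map T T (\<lambda>x. x \<otimes> inv g)"
    using assms(2) by (intro continuous_map_mult continuous_map_id[unfolded id_def])
      (simp add: topspace_eq_carrier)
  from openin_continuous_map_preimage[OF this assms(1)]
  show ?thesis by (simp add: topspace_eq_carrier)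
qed

lemma closedin_left_translate:
  assumes "closedin T W" "g \<in> carrier G"
  shows "closedin T {x \<in> carrier G. inv g \<otimes> x \<in> W}"
proof -
  have "continuous_map T T (\<lambda>x. inv g \<otimes> x)"
    using assms(2) by (intro continuous_map_mult continuous_map_id[unfolded id_def])
      (simp add: topspace_eq_carrier)
  from closedin_continuous_map_preimage[OF this assms(1)]
  show ?thesis by (simp add: topspace_eq_carrier)
qed

lemma openin_inverse_image:
  assumes "openin T W"
  shows "openin T {x \<in> carrier G. inv x \<in> W}"
  using openin_continuous_map_preimage[OF continuous_inv assms] by (simp add: topspace_eq_carrier)

lemma closedin_inverse_image:
  assumes "closedin T W"
  shows "closedin T {x \<in> carrier G. inv x \<in> W}"
  using closedin_continuous_map_preimage[OF continuous_inv assms] by (simp add: topspace_eq_carrier)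

text \<open>Closed rather than open, so that translates and countable intersections yield closed
  relations.\<close>

definition sym_nbhd :: "'a set \<Rightarrow> bool" where
  "sym_nbhd V \<longleftrightarrow> closedin T V \<and> (\<exists>U. openin T U \<and> \<one> \<in> U \<and> U \<subseteq> V) \<and> (\<forall>x \<in> V. inv x \<in> V)"

lemma sym_nbhd_subset_carrier: "sym_nbhd V \<Longrightarrow> V \<subseteq> carrier G"
  unfolding sym_nbhd_def using closedin_subset topspace_eq_carrier by blast

lemma sym_nbhd_one: "sym_nbhd V \<Longrightarrow> \<one> \<in> V"
  unfolding sym_nbhd_def by blast

text \<open>The product condition, with symmetry, makes \<open>\<Inter>n. V n\<close> a closed
  subgroup; this is the G_delta subgroup of the construction.\<close>

definition nbhd_seq :: "(nat \<Rightarrow> 'a set) \<Rightarrow> bool" where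
  "nbhd_seq V \<longleftrightarrow> (\<forall>n. sym_nbhd (V n) \<and> (\<forall>x \<in> V (Suc n). \<forall>y \<in> V (Suc n). x \<otimes> y \<in> V n))"

lemma open_square_subset:
  assumes "openin T U" "\<one> \<in> U"
  obtains W where "openin T W" "\<one> \<in> W" "\<forall>x \<in> W. \<forall>y \<in> W. x \<otimes> y \<in> U"
proof -
  let ?S = "{z \<in> topspace (prod_topology T T). (case z of (x, y) \<Rightarrow> x \<otimes> y) \<in> U}"
  have "openin (prod_topology T T) ?S"
    by (rule openin_continuous_map_preimage[OF continuous_mult assms(1)])
  moreover have "(\<one>, \<one>) \<in> ?S"
    using assms(2) by (simp add: topspace_eq_carrier)
  ultimately have "\<exists>A B. openin T A \<and> openin T B \<and> \<one> \<in> A \<and> \<one> \<in> B \<and> A \<times> B \<subseteq> ?S"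
    unfolding openin_prod_topology_alt[of T T ?S] by (elim allE[of _ \<one>] impE) auto
  then obtain A B where "openin T A" "openin T B" "\<one> \<in> A" "\<one> \<in> B" "A \<times> B \<subseteq> ?S" by blast
  then show thesis
    by (intro that[of "A \<inter> B"]) auto
qed

end

context compact_group
begin

lemma regular: "regular_space T"
  using compact_Hausdorff_imp_regular_space[OF compact Hausdorff] .

lemma regularE:
  assumes "openin T U" "x \<in> U"
  obtains W C where "openin T W" "closedin T C" "x \<in> W" "W \<subseteq> C" "C \<subseteq> U"
proof -
  have "neighbourhood_base_of (closedin T) T"
    using regular by (simp add: neighbourhood_base_of_closedin)
  then have "\<exists>W C. openin T W \<and> closedin T C \<and> x \<in> W \<and> W \<subseteq> C \<and> C \<subseteq> U"
    using assms unfolding neighbourhood_base_of by (elim allE[of _ U] allE[of _ x]) blast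
  then show thesis using that by auto
qed

lemma sym_nbhd_square_subset:
  assumes "openin T U" "\<one> \<in> U"
  obtains V where "sym_nbhd V" "V \<subseteq> U" "\<forall>x \<in> V. \<forall>y \<in> V. x \<otimes> y \<in> U"
proof -
  obtain W where W: "openin T W" "\<one> \<in> W" "\<forall>x \<in> W. \<forall>y \<in> W. x \<otimes> y \<in> U"
    using open_square_subset[OF assms] by blast
  obtain O' C where C: "openin T O'" "closedin T C" "\<one> \<in> O'" "O' \<subseteq> C" "C \<subseteq> W \<inter> U"
    by (rule regularE[of "W \<inter> U" \<one>]) (use W assms in auto)
  have carr: "C \<subseteq> carrier G" using closedin_subset[OF C(2)] topspace_eq_carrier by simp
  let ?V = "C \<inter> {x \<in> carrier G. inv x \<in> C}"
  have "sym_nbhd ?V"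
    unfolding sym_nbhd_def
  proof (intro conjI exI[of _ "O' \<inter> {x \<in> carrier G. inv x \<in> O'}"] ballI)
    show "closedin T ?V" using C(2) closedin_inverse_image by blast
    show "openin T (O' \<inter> {x \<in> carrier G. inv x \<in> O'})" using C(1) openin_inverse_image by blast
  qed (use C(3,4) carr in auto)
  moreover have "?V \<subseteq> U" "?V \<subseteq> W" using C(5) by auto
  ultimately show thesis
    using W(3) that by (meson subsetD)
qed

lemma nbhd_seq_exists:
  assumes "openin T U" "\<one> \<in> U"
  obtains V where "nbhd_seq V" "V 0 \<subseteq> U"
proof -
  let ?P = "\<lambda>(n :: nat) V. sym_nbhd V \<and> V \<subseteq> U"
  let ?Q = "\<lambda>(n :: nat) V V'. \<forall>x \<in> V'. \<forall>y \<in> V'. x \<otimes> y \<in> V"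
  have "\<exists>V. \<forall>n. ?P n (V n) \<and> ?Q n (V n) (V (Suc n))"
  proof (rule dependent_nat_choice[of ?P ?Q])
    obtain V where "sym_nbhd V" "V \<subseteq> U" by (rule sym_nbhd_square_subset[OF assms])
    then show "\<exists>V. sym_nbhd V \<and> V \<subseteq> U" by blast
  next
    fix V and n :: nat assume V: "sym_nbhd V \<and> V \<subseteq> U"
    then obtain W where W: "openin T W" "\<one> \<in> W" "W \<subseteq> V" unfolding sym_nbhd_def by blast
    obtain V' where "sym_nbhd V'" "V' \<subseteq> W" "\<forall>x \<in> V'. \<forall>y \<in> V'. x \<otimes> y \<in> W"
      by (rule sym_nbhd_square_subset[OF W(1,2)])
    then show "\<exists>V'. (sym_nbhd V' \<and> V' \<subseteq> U) \<and> (\<forall>x \<in> V'. \<forall>y \<in> V'. x \<otimes> y \<in> V)"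
      using V W(3) by (intro exI[of _ V']) blast
  qed
  then obtain V where "\<forall>n. ?P n (V n) \<and> ?Q n (V n) (V (Suc n))" ..
  then show thesis by (intro that[of V]) (simp_all add: nbhd_seq_def)
qed

end

section \<open>Coherent sequences of centres and the left cosets they cut out\<close>

context topological_group
begin

lemma nbhd_seqD:
  assumes "nbhd_seq V"
  shows "sym_nbhd (V n)" "x \<in> V (Suc n) \<Longrightarrow> y \<in> V (Suc n) \<Longrightarrow> x \<otimes> y \<in> V n"
    "V n \<subseteq> carrier G" "\<one> \<in> V n" "x \<in> V n \<Longrightarrow> inv x \<in> V n" "closedin T (V n)"
proof -
  have V: "sym_nbhd (V n)" "\<forall>x \<in> V (Suc n). \<forall>y \<in> V (Suc n). x \<otimes> y \<in> V n"
    using assms by (auto simp: nbhd_seq_def)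
  then show "sym_nbhd (V n)" "x \<in> V (Suc n) \<Longrightarrow> y \<in> V (Suc n) \<Longrightarrow> x \<otimes> y \<in> V n" by auto
  show "V n \<subseteq> carrier G" "\<one> \<in> V n" "x \<in> V n \<Longrightarrow> inv x \<in> V n" "closedin T (V n)"
    using V(1) sym_nbhd_one sym_nbhd_subset_carrier by (auto simp: sym_nbhd_def)
qed

lemma nbhd_seq_mono:
  assumes "nbhd_seq V" "m \<le> n"
  shows "V n \<subseteq> V m"
proof -
  have "V (Suc k) \<subseteq> V k" for k
  proof
    fix x assume x: "x \<in> V (Suc k)"
    then have "x \<in> carrier G" using nbhd_seqD(3)[OF assms(1)] by blast
    then show "x \<in> V k"
      using nbhd_seqD(2)[OF assms(1) x nbhd_seqD(4)[OF assms(1)]] by simp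
  qed
  then show ?thesis using lift_Suc_antimono_le[of V] assms(2) by blast
qed

text \<open>A coherent sequence of centres \<open>c n\<close> makes the sets \<open>c n V\<^sub>n\<close> decreasing, and their
  intersection a left coset of \<open>\<Inter>n. V\<^sub>n\<close> as soon as it is nonempty; the index \<open>n + 2\<close> leaves room
  for the right factor from \<open>\<Inter>n. V\<^sub>n\<close>.\<close>

definition coherent :: "(nat \<Rightarrow> 'a set) \<Rightarrow> (nat \<Rightarrow> 'a) \<Rightarrow> bool" where
  "coherent V c \<longleftrightarrow> (\<forall>n. c n \<in> carrier G \<and> inv (c n) \<otimes> c (Suc n) \<in> V (n + 2))"

definition tracks :: "(nat \<Rightarrow> 'a set) \<Rightarrow> (nat \<Rightarrow> 'a) \<Rightarrow> 'a \<Rightarrow> bool" where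
  "tracks V c g \<longleftrightarrow> g \<in> carrier G \<and> (\<forall>n. inv (c n) \<otimes> g \<in> V n)"

lemma coherent_step:
  assumes V: "nbhd_seq V" and c: "coherent V c" and g: "g \<in> carrier G"
    and "inv (c (Suc n)) \<otimes> g \<in> V (Suc n)"
  shows "inv (c n) \<otimes> g \<in> V n"
proof -
  have "inv (c n) \<otimes> c (Suc n) \<in> V (Suc n)"
    using c nbhd_seq_mono[OF V, of "Suc n" "n + 2"] unfolding coherent_def by auto
  from nbhd_seqD(2)[OF V this assms(4)]
  have "inv (c n) \<otimes> c (Suc n) \<otimes> (inv (c (Suc n)) \<otimes> g) \<in> V n" .
  moreover have "inv (c n) \<otimes> c (Suc n) \<otimes> (inv (c (Suc n)) \<otimes> g) = inv (c n) \<otimes> g"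
    using c g unfolding coherent_def by (simp add: m_assoc mult_inv_mult_cancel)
  ultimately show ?thesis by simp
qed

text \<open>Both points lie in the translate of \<open>V (Suc n)\<close> by
  \<open>c (Suc n)\<close>, and comparing them through this centre costs one index.\<close>

lemma tracks_diff:
  assumes V: "nbhd_seq V" and c: "\<And>n. c n \<in> carrier G" and g: "tracks V c g" and h: "tracks V c h"
  shows "inv g \<otimes> h \<in> (\<Inter>n. V n)"
proof
  fix n
  have "inv (c (Suc n)) \<otimes> g \<in> V (Suc n)" "inv (c (Suc n)) \<otimes> h \<in> V (Suc n)"
    using g h unfolding tracks_def by auto
  then have "inv (inv (c (Suc n)) \<otimes> g) \<otimes> (inv (c (Suc n)) \<otimes> h) \<in> V n"
    by (blast intro: nbhd_seqD(2)[OF V] nbhd_seqD(5)[OF V])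
  moreover have "inv (inv (c (Suc n)) \<otimes> g) \<otimes> (inv (c (Suc n)) \<otimes> h) = inv g \<otimes> h"
    using c g h by (simp add: tracks_def inv_mult_group m_assoc mult_inv_mult_cancel)
  ultimately show "inv g \<otimes> h \<in> V n" by simp
qed

text \<open>Right multiplication by an element of the intersection loses one index, and the return
  from \<open>c (n + 2)\<close> to \<open>c n\<close> loses another; starting at index
  \<open>n + 2\<close>, the product ends in \<open>V n\<close>.\<close>

lemma tracks_coset:
  assumes V: "nbhd_seq V" and c: "coherent V c" and g: "tracks V c g"
    and h: "h \<in> carrier G" "inv g \<otimes> h \<in> (\<Inter>n. V n)"
  shows "tracks V c h"
  unfolding tracks_def
proof (intro conjI allI)
  fix n
  have carr: "c k \<in> carrier G" "g \<in> carrier G" for k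
    using c g unfolding coherent_def tracks_def by auto
  have "inv (c (n + 2)) \<otimes> h = (inv (c (n + 2)) \<otimes> g) \<otimes> (inv g \<otimes> h)"
    using carr h by (simp add: m_assoc mult_inv_mult_cancel)
  also have "\<dots> \<in> V (Suc n)"
  proof (rule nbhd_seqD(2)[OF V])
    show "inv (c (n + 2)) \<otimes> g \<in> V (Suc (Suc n))"
      using g unfolding tracks_def by (metis add_2_eq_Suc')
  qed (use h(2) in auto)
  finally have 1: "inv (c (n + 2)) \<otimes> h \<in> V (Suc n)" .
  have "inv (c n) \<otimes> c (Suc n) \<otimes> (inv (c (Suc n)) \<otimes> c (n + 2)) \<in> V (Suc n)"
  proof (rule nbhd_seqD(2)[OF V])
    show "inv (c n) \<otimes> c (Suc n) \<in> V (Suc (Suc n))"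
      using c[unfolded coherent_def, THEN spec[of _ n]] by simp
    have "inv (c (Suc n)) \<otimes> c (n + 2) \<in> V (n + 3)"
      using c[unfolded coherent_def, THEN spec[of _ "Suc n"]] by (simp add: eval_nat_numeral)
    then show "inv (c (Suc n)) \<otimes> c (n + 2) \<in> V (Suc (Suc n))"
      using nbhd_seq_mono[OF V, of "Suc (Suc n)" "n + 3"] by auto
  qed
  from nbhd_seqD(2)[OF V this 1]
  have "inv (c n) \<otimes> c (Suc n) \<otimes> (inv (c (Suc n)) \<otimes> c (n + 2)) \<otimes> (inv (c (n + 2)) \<otimes> h) \<in> V n" .
  moreover have "inv (c n) \<otimes> c (Suc n) \<otimes> (inv (c (Suc n)) \<otimes> c (n + 2)) \<otimes> (inv (c (n + 2)) \<otimes> h)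
      = inv (c n) \<otimes> h"
    using carr h by (simp add: m_assoc mult_inv_mult_cancel)
  ultimately show "inv (c n) \<otimes> h \<in> V n" by simp
qed (rule h)

end

section \<open>Selections for coset-valued relations\<close>

context compact_group
begin

text \<open>Stands for a partial map into the left coset space of \<open>N\<close> without a
  quotient type: for a subgroup \<open>N\<close>, a fibre inside \<open>carrier G\<close> is empty
  or a left coset. Empty fibres make room for partial selections.\<close>

definition coset_valued :: "'a set \<Rightarrow> ('x \<times> 'a) set \<Rightarrow> bool" where
  "coset_valued N R \<longleftrightarrow>
     (\<forall>x g h. (x, g) \<in> R \<longrightarrow> h \<in> carrier G \<longrightarrow> ((x, h) \<in> R \<longleftrightarrow> inv g \<otimes> h \<in> N))"

lemma closedin_subset_carrier:
  "closedin (prod_topology X T) R \<Longrightarrow> R \<subseteq> topspace X \<times> carrier G"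
  using closedin_subset topspace_eq_carrier by fastforce

text \<open>Lower semicontinuity: a coset of \<open>N\<close> meets \<open>W\<close> iff it lies in the open set \<open>W N\<close>.\<close>

lemma openin_fibre_meets:
  assumes N: "subgroup N G" and R: "closedin (prod_topology X T) R" "coset_valued N R"
    and W: "openin T W"
  shows "openin X {x \<in> topspace X. R `` {x} = {} \<or> R `` {x} \<inter> W \<noteq> {}}"
proof -
  let ?WN = "\<Union>n \<in> N. {y \<in> carrier G. y \<otimes> inv n \<in> W}"
  note NG = subgroup.subset[OF N]
  have R_carr: "(x, g) \<in> R \<Longrightarrow> g \<in> carrier G" for x g
    using closedin_subset_carrier[OF R(1)] by blast
  have "openin T ?WN"
    using openin_right_translate[OF W] NG by blast
  then have "openin X {x \<in> topspace X. R `` {x} \<subseteq> ?WN}"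
    by (rule openin_fibre_subset[OF compact R(1)])
  \<comment> \<open>An empty fibre satisfies the containment vacuously, whence the extra
    disjunct.\<close>
  moreover have "R `` {x} \<subseteq> ?WN \<longleftrightarrow> R `` {x} = {} \<or> R `` {x} \<inter> W \<noteq> {}" for x
  proof
    assume sub: "R `` {x} \<subseteq> ?WN"
    have "R `` {x} \<inter> W \<noteq> {}" if g: "(x, g) \<in> R" for g
    proof -
      obtain n where n: "n \<in> N" "g \<otimes> inv n \<in> W" using sub g by auto
      have carr: "g \<in> carrier G" "n \<in> carrier G" using g n NG R_carr by auto
      have "inv g \<otimes> (g \<otimes> inv n) = inv n" using carr by (simp flip: m_assoc)
      then have "(x, g \<otimes> inv n) \<in> R"
        using R(2) g n carr subgroup.m_inv_closed[OF N n(1)] unfolding coset_valued_def by auto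
      then show ?thesis using n(2) by blast
    qed
    then show "R `` {x} = {} \<or> R `` {x} \<inter> W \<noteq> {}" by blast
  next
    assume "R `` {x} = {} \<or> R `` {x} \<inter> W \<noteq> {}"
    moreover have "R `` {x} \<subseteq> ?WN" if w: "(x, w) \<in> R" "w \<in> W" for w
    proof
      fix g assume g: "g \<in> R `` {x}"
      then have carr: "g \<in> carrier G" "w \<in> carrier G" using w R_carr by auto
      have "inv w \<otimes> g \<in> N" using R(2) w g carr unfolding coset_valued_def by blast
      moreover have "g \<otimes> inv (inv w \<otimes> g) = w"
        using carr by (simp add: inv_mult_group flip: m_assoc)
      ultimately show "g \<in> ?WN" using w(2) carr by (intro UN_I[of "inv w \<otimes> g"]) auto
    qed
    ultimately show "R `` {x} \<subseteq> ?WN" by blast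
  qed
  ultimately show ?thesis by simp
qed

text \<open>The complement is a union, over the values \<open>v\<close> of \<open>c\<close>, of open
  rectangles: a level set of \<open>c\<close> times the complement of the translate of
  \<open>V\<close> by \<open>v\<close>.\<close>

lemma closedin_locally_constant_translate:
  assumes c: "locally_constant X c" "\<And>x. x \<in> topspace X \<Longrightarrow> c x \<in> carrier G" and V: "closedin T V"
  shows "closedin (prod_topology X T) {(x, g). x \<in> topspace X \<and> g \<in> carrier G \<and> inv (c x) \<otimes> g \<in> V}"
    (is "closedin _ ?S")
proof -
  let ?B = "\<lambda>v. {x \<in> topspace X. c x = v} \<times> (topspace T - {g \<in> carrier G. inv v \<otimes> g \<in> V})"
  have "openin (prod_topology X T) (?B v)" if "v \<in> carrier G" for v
    using locally_constantD[OF c(1)] closedin_left_translate[OF V that]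
    by (simp add: openin_prod_Times_iff openin_diff)
  then have "openin (prod_topology X T) (\<Union>v \<in> carrier G. ?B v)" by blast
  moreover have "topspace (prod_topology X T) - ?S = (\<Union>v \<in> carrier G. ?B v)"
    using c(2) by (auto simp: topspace_eq_carrier)
  moreover have "?S \<subseteq> topspace (prod_topology X T)" by (auto simp: topspace_eq_carrier)
  ultimately show ?thesis unfolding closedin_def by simp
qed

text \<open>Successive approximation as in Michael's theorem. The next centre near \<open>x\<close>
  is a point \<open>r\<close> of \<open>E x\<close> that the old centre already approximates:
  coherence is then the old approximation, and the openness hypothesis \<open>meets\<close> keeps
  \<open>r\<close> close to \<open>E\<close> at nearby points. The recursion works at index
  \<open>n + 2\<close>, as \<open>coherent\<close> demands.\<close>

lemma approximate_selections:
  fixes E :: "'x \<Rightarrow> 'a set"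
  assumes X: "compact_space X" "zero_dimensional X" and V: "nbhd_seq V"
    and E: "\<And>x. x \<in> topspace X \<Longrightarrow> E x \<noteq> {}" "\<And>x. x \<in> topspace X \<Longrightarrow> E x \<subseteq> carrier G"
    and meets: "\<And>W. openin T W \<Longrightarrow> openin X {x \<in> topspace X. E x \<inter> W \<noteq> {}}"
  obtains c where "\<And>n. locally_constant X (c n)"
    "\<And>x. x \<in> topspace X \<Longrightarrow> coherent V (\<lambda>n. c n x)"
    "\<And>n x. x \<in> topspace X \<Longrightarrow> \<exists>g \<in> E x. inv (c n x) \<otimes> g \<in> V n"
proof -
  let ?near = "\<lambda>(n :: nat) x v. v \<in> carrier G \<and> (\<exists>g \<in> E x. inv v \<otimes> g \<in> V (n + 2))"
  let ?P = "\<lambda>n c. locally_constant X c \<and> (\<forall>x \<in> topspace X. ?near n x (c x))"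
  let ?Q = "\<lambda>n c c'. \<forall>x \<in> topspace X. inv (c x) \<otimes> c' x \<in> V (n + 2)"
  have near: "\<exists>U. openin X U \<and> x \<in> U \<and> (\<forall>y \<in> U. ?near n y r)" if x: "x \<in> topspace X" "r \<in> E x" for n x r
  proof -
    have r: "r \<in> carrier G" using E(2) x by blast
    obtain O' where O': "openin T O'" "\<one> \<in> O'" "O' \<subseteq> V (n + 2)"
      using nbhd_seqD(1)[OF V] unfolding sym_nbhd_def by blast
    let ?W = "{g \<in> carrier G. inv r \<otimes> g \<in> O'}"
    have "openin X {y \<in> topspace X. E y \<inter> ?W \<noteq> {}}"
      by (intro meets openin_left_translate O' r)
    moreover have "r \<in> E x \<inter> ?W" using x r O' by simp
    ultimately show ?thesis using x r O'(3) by (intro exI[of _ "{y \<in> topspace X. E y \<inter> ?W \<noteq> {}}"]) blast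
  qed
  have "\<exists>c. \<forall>n. ?P n (c n) \<and> ?Q n (c n) (c (Suc n))"
  proof (rule dependent_nat_choice[of ?P ?Q])
    have "\<exists>v U. openin X U \<and> x \<in> U \<and> (\<forall>y \<in> U. ?near 0 y v)" if "x \<in> topspace X" for x
      using E(1)[OF that] near[OF that] by blast
    then obtain c where "locally_constant X c" "\<And>x. x \<in> topspace X \<Longrightarrow> ?near 0 x (c x)"
      by (rule locally_constant_choice[OF X, where \<Phi> = "?near 0"]) blast+
    then show "\<exists>c. ?P 0 c" by blast
  next
    fix c and n :: nat assume c: "?P n c"
    let ?\<Phi> = "\<lambda>y v. ?near (Suc n) y v \<and> inv (c y) \<otimes> v \<in> V (n + 2)"
    have "\<exists>v U. openin X U \<and> x \<in> U \<and> (\<forall>y \<in> U. ?\<Phi> y v)" if x: "x \<in> topspace X" for x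
    proof -
      obtain r where r: "r \<in> E x" "inv (c x) \<otimes> r \<in> V (n + 2)" using c x by blast
      obtain U where U: "openin X U" "x \<in> U" "\<forall>y \<in> U. ?near (Suc n) y r"
        using near[OF x r(1)] by blast
      let ?U = "U \<inter> {y \<in> topspace X. c y = c x}"
      have "openin X ?U" using c by (intro openin_Int U(1) locally_constantD) auto
      then show ?thesis using U(2,3) r(2) x by (intro exI[of _ r] exI[of _ ?U]) auto
    qed
    then obtain c' where "locally_constant X c'" "\<And>x. x \<in> topspace X \<Longrightarrow> ?\<Phi> x (c' x)"
      by (rule locally_constant_choice[OF X, where \<Phi> = ?\<Phi>]) blast+
    then show "\<exists>c'. ?P (Suc n) c' \<and> ?Q n c c'" by blast
  qed
  then obtain c where c: "\<And>n. ?P n (c n)" "\<And>n. ?Q n (c n) (c (Suc n))" by blast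
  show thesis
  proof (rule that[of c])
    show "coherent V (\<lambda>n. c n x)" if "x \<in> topspace X" for x
      using c that unfolding coherent_def by blast
    show "\<exists>g \<in> E x. inv (c n x) \<otimes> g \<in> V n" if "x \<in> topspace X" for n x
      using c(1)[of n] that nbhd_seq_mono[OF V, of n "n + 2"] by fastforce
  qed (use c in blast)
qed

text \<open>Compactness takes the place of completeness: coherence makes the closed sets of points
  of \<open>K\<close> in the translate of \<open>V n\<close> by \<open>c n\<close> decrease.\<close>

lemma tracked_fibre_nonempty:
  assumes V: "nbhd_seq V" and c: "coherent V c" and K: "closedin T K"
    and near: "\<And>n. \<exists>g \<in> K. inv (c n) \<otimes> g \<in> V n"
  shows "\<exists>g \<in> K. tracks V c g"
proof -
  let ?C = "\<lambda>n. K \<inter> {g \<in> carrier G. inv (c n) \<otimes> g \<in> V n}"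
  have carr: "c n \<in> carrier G" for n using c unfolding coherent_def by blast
  have "(\<Inter>n. ?C n) \<noteq> {}"
  proof (rule compact_space_imp_nest[OF compact])
    show "closedin T (?C n)" for n
      using closedin_Int[OF K closedin_left_translate[OF nbhd_seqD(6)[OF V] carr]] .
    show "?C n \<noteq> {}" for n
      using near[of n] closedin_subset[OF K] topspace_eq_carrier by blast
    show "decseq ?C"
      unfolding decseq_Suc_iff using coherent_step[OF V c] by blast
  qed
  then show ?thesis unfolding tracks_def by auto
qed

text \<open>Michael's zero-dimensional selection theorem, relative to the partial selection \<open>F\<close>: it gives
  a continuous section over the coset space of \<open>N \<inter> M\<close> of a map to the coset space of \<open>N\<close>.\<close>

lemma coset_selection:
  assumes X: "compact_space X" "zero_dimensional X" and V: "nbhd_seq V"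
    and M: "M = (\<Inter>n. V n)" and N: "subgroup N G" "subgroup (N \<inter> M) G"
    and R: "closedin (prod_topology X T) R" "coset_valued N R"
      "\<And>x. x \<in> topspace X \<Longrightarrow> \<exists>g. (x, g) \<in> R"
    and F: "closedin (prod_topology X T) F" "coset_valued (N \<inter> M) F" "F \<subseteq> R"
  obtains S where "closedin (prod_topology X T) S" "coset_valued (N \<inter> M) S"
    "\<And>x. x \<in> topspace X \<Longrightarrow> \<exists>g. (x, g) \<in> S" "F \<subseteq> S" "S \<subseteq> R"
proof -
  let ?E = "\<lambda>x. if F `` {x} = {} then R `` {x} else F `` {x}"
  have R_carr: "R \<subseteq> topspace X \<times> carrier G" by (rule closedin_subset_carrier[OF R(1)])
  have "openin X {x \<in> topspace X. ?E x \<inter> W \<noteq> {}}" if W: "openin T W" for W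
  proof -
    \<comment> \<open>Since \<open>F \<subseteq> R\<close>, a prescribed fibre meeting
      \<open>W\<close> forces the fibre of \<open>R\<close> to meet it too, and where
      \<open>F\<close> is empty only the condition on \<open>R\<close> remains; so the two open
      conditions together describe \<open>?E\<close>.\<close>
    have "openin X ({x \<in> topspace X. R `` {x} = {} \<or> R `` {x} \<inter> W \<noteq> {}}
        \<inter> {x \<in> topspace X. F `` {x} = {} \<or> F `` {x} \<inter> W \<noteq> {}})"
      by (intro openin_Int openin_fibre_meets[OF N(1) R(1,2) W] openin_fibre_meets[OF N(2) F(1,2) W])
    moreover have "{x \<in> topspace X. R `` {x} = {} \<or> R `` {x} \<inter> W \<noteq> {}}
        \<inter> {x \<in> topspace X. F `` {x} = {} \<or> F `` {x} \<inter> W \<noteq> {}} = {x \<in> topspace X. ?E x \<inter> W \<noteq> {}}"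
      using R(3) F(3) by auto
    ultimately show ?thesis by simp
  qed
  moreover have "?E x \<noteq> {}" "?E x \<subseteq> carrier G" if "x \<in> topspace X" for x
    using R(3)[OF that] R_carr F(3) by auto
  ultimately obtain c where c: "\<And>n. locally_constant X (c n)"
    "\<And>x. x \<in> topspace X \<Longrightarrow> coherent V (\<lambda>n. c n x)"
    "\<And>n x. x \<in> topspace X \<Longrightarrow> \<exists>g \<in> ?E x. inv (c n x) \<otimes> g \<in> V n"
    using approximate_selections[OF X V, of ?E] by blast
  have c_carr: "x \<in> topspace X \<Longrightarrow> c n x \<in> carrier G" for n x
    using c(2) unfolding coherent_def by blast
  let ?S = "R \<inter> (\<Inter>n. {(x, g). x \<in> topspace X \<and> g \<in> carrier G \<and> inv (c n x) \<otimes> g \<in> V n})"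
  have S_iff: "(x, g) \<in> ?S \<longleftrightarrow> (x, g) \<in> R \<and> tracks V (\<lambda>n. c n x) g" for x g
    using R_carr unfolding tracks_def by auto
  have closed: "closedin (prod_topology X T) ?S"
    by (intro closedin_Int R(1) closedin_Inter)
      (auto intro!: closedin_locally_constant_translate c c_carr nbhd_seqD(6)[OF V])
  have coset: "coset_valued (N \<inter> M) ?S"
    unfolding coset_valued_def
  proof (intro allI impI)
    fix x g h assume g: "(x, g) \<in> ?S" and h: "h \<in> carrier G"
    have x: "x \<in> topspace X" using g R_carr by blast
    have g': "(x, g) \<in> R" "tracks V (\<lambda>n. c n x) g" using g unfolding S_iff by auto
    have "(x, h) \<in> R \<longleftrightarrow> inv g \<otimes> h \<in> N"
      using R(2) g'(1) h unfolding coset_valued_def by blast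
    moreover have "tracks V (\<lambda>n. c n x) h \<longleftrightarrow> inv g \<otimes> h \<in> M"
      using tracks_diff[OF V c_carr[OF x] g'(2)] tracks_coset[OF V c(2)[OF x] g'(2) h] M by blast
    ultimately show "(x, h) \<in> ?S \<longleftrightarrow> inv g \<otimes> h \<in> N \<inter> M" unfolding S_iff by blast
  qed
  have closed_E: "closedin T (?E x)" if "x \<in> topspace X" for x
    using closedin_fibre[OF R(1) that] closedin_fibre[OF F(1) that] by simp
  have E_S: "\<exists>g \<in> ?E x. (x, g) \<in> ?S" if x: "x \<in> topspace X" for x
  proof -
    obtain g where "g \<in> ?E x" "tracks V (\<lambda>n. c n x) g"
      using tracked_fibre_nonempty[OF V c(2)[OF x] closed_E[OF x] c(3)[OF x]] by blast
    moreover have "(x, g) \<in> R" using \<open>g \<in> ?E x\<close> F(3) by (auto split: if_splits)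
    ultimately show ?thesis unfolding S_iff by blast
  qed
  \<comment> \<open>Where \<open>F\<close> has a nonempty fibre, \<open>?E\<close> made it share an
    element with \<open>?S\<close>; both fibres are cosets of the same subgroup, hence
    equal.\<close>
  have "F \<subseteq> ?S"
  proof
    fix z assume "z \<in> F"
    then obtain x f where z: "z = (x, f)" "(x, f) \<in> F" by (cases z) blast
    then have x: "x \<in> topspace X" and f: "f \<in> carrier G" using F(3) R_carr by auto
    obtain g where g: "(x, g) \<in> F" "(x, g) \<in> ?S" using E_S[OF x] z(2) by (auto split: if_splits)
    then have "inv g \<otimes> f \<in> N \<inter> M" using F(2) z(2) f unfolding coset_valued_def by blast
    then show "z \<in> ?S" using coset g(2) f z(1) unfolding coset_valued_def by blast
  qed
  then show thesis using closed coset E_S by (intro that[of ?S]) blast+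
qed

end

section \<open>Cylinder topologies\<close>

text \<open>The open sets of \<open>cylinder_topology P A\<close> are the open sets of the product of discrete spaces
  that depend only on the coordinates in \<open>A\<close>; closed relations thereby record the coordinates
  on which they depend. The topology is not Hausdorff in general.\<close>

definition cylinder_topology :: "('j \<Rightarrow> 'c) set \<Rightarrow> 'j set \<Rightarrow> ('j \<Rightarrow> 'c) topology" where
  "cylinder_topology P A = topology (\<lambda>U. U \<subseteq> P \<and>
     (\<forall>x \<in> U. \<exists>F. finite F \<and> F \<subseteq> A \<and> (\<forall>y \<in> P. (\<forall>j \<in> F. y j = x j) \<longrightarrow> y \<in> U)))"

lemma openin_cylinder_topology:
  "openin (cylinder_topology P A) U \<longleftrightarrow> U \<subseteq> P \<and>
     (\<forall>x \<in> U. \<exists>F. finite F \<and> F \<subseteq> A \<and> (\<forall>y \<in> P. (\<forall>j \<in> F. y j = x j) \<longrightarrow> y \<in> U))"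
proof -
  let ?op = "\<lambda>U. U \<subseteq> P \<and>
     (\<forall>x \<in> U. \<exists>F. finite F \<and> F \<subseteq> A \<and> (\<forall>y \<in> P. (\<forall>j \<in> F. y j = x j) \<longrightarrow> y \<in> U))"
  have "istopology ?op"
    unfolding istopology_def
  proof (rule conjI; intro allI impI)
    fix U V assume U: "?op U" and V: "?op V"
    have "\<exists>F. finite F \<and> F \<subseteq> A \<and> (\<forall>y \<in> P. (\<forall>j \<in> F. y j = x j) \<longrightarrow> y \<in> U \<inter> V)" if x: "x \<in> U \<inter> V" for x
    proof -
      obtain F where "finite F" "F \<subseteq> A" "\<forall>y \<in> P. (\<forall>j \<in> F. y j = x j) \<longrightarrow> y \<in> U" using U x by blast
      moreover obtain F' where "finite F'" "F' \<subseteq> A" "\<forall>y \<in> P. (\<forall>j \<in> F'. y j = x j) \<longrightarrow> y \<in> V" using V x by blast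
      ultimately show ?thesis by (intro exI[of _ "F \<union> F'"]) auto
    qed
    then show "?op (U \<inter> V)" using U by blast
  next
    fix \<U> assume \<U>: "\<forall>U \<in> \<U>. ?op U"
    have "\<exists>F. finite F \<and> F \<subseteq> A \<and> (\<forall>y \<in> P. (\<forall>j \<in> F. y j = x j) \<longrightarrow> y \<in> \<Union>\<U>)" if x: "x \<in> \<Union>\<U>" for x
    proof -
      obtain U where U: "U \<in> \<U>" "x \<in> U" using x by blast
      then have "?op U" using \<U> by simp
      then obtain F where "finite F" "F \<subseteq> A" "\<forall>y \<in> P. (\<forall>j \<in> F. y j = x j) \<longrightarrow> y \<in> U" using U(2) by meson
      then show ?thesis using U(1) by (intro exI[of _ F]) auto
    qed
    then show "?op (\<Union>\<U>)" using \<U> by blast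
  qed
  then show ?thesis unfolding cylinder_topology_def by (simp add: topology_inverse')
qed

lemma topspace_cylinder_topology [simp]: "topspace (cylinder_topology P A) = P"
proof -
  have "openin (cylinder_topology P A) P" unfolding openin_cylinder_topology by blast
  moreover have "topspace (cylinder_topology P A) \<subseteq> P"
    using openin_topspace[of "cylinder_topology P A"] unfolding openin_cylinder_topology by blast
  ultimately show ?thesis using openin_subset by blast
qed

lemma openin_cylinder_topology_mono:
  "A \<subseteq> B \<Longrightarrow> openin (cylinder_topology P A) U \<Longrightarrow> openin (cylinder_topology P B) U"
  unfolding openin_cylinder_topology by (meson order_trans)

lemma closedin_prod_cylinder_topology_mono:
  assumes "A \<subseteq> B" "closedin (prod_topology (cylinder_topology P A) Y) R"
  shows "closedin (prod_topology (cylinder_topology P B) Y) R"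
proof -
  have "openin (prod_topology (cylinder_topology P B) Y) S"
    if "openin (prod_topology (cylinder_topology P A) Y) S" for S
    using that openin_cylinder_topology_mono[OF assms(1)] unfolding openin_prod_topology_alt by meson
  then show ?thesis using assms(2) unfolding closedin_def by auto
qed

lemma openin_cylinder_topology_finite:
  assumes "finite F" "F \<subseteq> A" "U \<subseteq> P"
    and "\<And>x y. x \<in> U \<Longrightarrow> y \<in> P \<Longrightarrow> (\<And>j. j \<in> F \<Longrightarrow> y j = x j) \<Longrightarrow> y \<in> U"
  shows "openin (cylinder_topology P A) U"
  unfolding openin_cylinder_topology
  by (intro conjI ballI exI[of _ F] impI assms(1-3)) (auto intro: assms(4))

lemma zero_dimensional_cylinder_topology: "zero_dimensional (cylinder_topology P A)"
  unfolding zero_dimensional_def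
proof (intro allI impI, elim conjE)
  fix U x assume U: "openin (cylinder_topology P A) U" "x \<in> U"
  then obtain F where F: "finite F" "F \<subseteq> A" "\<forall>y \<in> P. (\<forall>j \<in> F. y j = x j) \<longrightarrow> y \<in> U"
    unfolding openin_cylinder_topology by blast
  have x: "x \<in> P" using openin_subset[OF U(1)] U(2) by auto
  let ?K = "{y \<in> P. \<forall>j \<in> F. y j = x j}"
  have "openin (cylinder_topology P A) ?K"
    by (rule openin_cylinder_topology_finite[OF F(1,2)]) auto
  moreover have "openin (cylinder_topology P A) (P - ?K)"
    by (rule openin_cylinder_topology_finite[OF F(1,2)]) auto
  then have "closedin (cylinder_topology P A) ?K"
    unfolding closedin_def by auto
  ultimately show "\<exists>K. openin (cylinder_topology P A) K \<and> closedin (cylinder_topology P A) K \<and> x \<in> K \<and> K \<subseteq> U"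
    using F(3) x by (intro exI[of _ ?K]) blast
qed

lemma locally_constant_cylinder_topology:
  assumes "finite F" "F \<subseteq> A"
    and "\<And>x y. x \<in> P \<Longrightarrow> y \<in> P \<Longrightarrow> (\<And>j. j \<in> F \<Longrightarrow> y j = x j) \<Longrightarrow> f y = f x"
  shows "locally_constant (cylinder_topology P A) f"
  unfolding locally_constant_def
proof
  fix Y
  show "openin (cylinder_topology P A) {x \<in> topspace (cylinder_topology P A). f x \<in> Y}"
  proof (rule openin_cylinder_topology_finite[OF assms(1,2)])
    fix x y
    assume "x \<in> {x \<in> topspace (cylinder_topology P A). f x \<in> Y}" "y \<in> P" "\<And>j. j \<in> F \<Longrightarrow> y j = x j"
    then show "y \<in> {x \<in> topspace (cylinder_topology P A). f x \<in> Y}"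
      using assms(3)[of x y] by simp
  qed auto
qed

text \<open>The topology is coarser than the product of finite discrete spaces, which is compact by
  Tychonoff's theorem.\<close>

lemma compact_space_cylinder_topology:
  assumes "\<And>j. j \<in> J \<Longrightarrow> finite (C j)" "A \<subseteq> J"
  shows "compact_space (cylinder_topology (PiE J C) A)"
proof -
  let ?X = "product_topology (\<lambda>j. discrete_topology (C j)) J"
  have "openin ?X U" if U: "openin (cylinder_topology (PiE J C) A) U" for U
    unfolding openin_product_topology_alt
  proof
    fix x assume x: "x \<in> U"
    then obtain F where F: "finite F" "F \<subseteq> A" "\<forall>y \<in> PiE J C. (\<forall>j \<in> F. y j = x j) \<longrightarrow> y \<in> U"
      using U unfolding openin_cylinder_topology by blast
    have xP: "x \<in> PiE J C" using openin_subset[OF U] x by auto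
    let ?W = "\<lambda>j. if j \<in> F then {x j} else C j"
    have "finite {j \<in> J. ?W j \<noteq> topspace (discrete_topology (C j))}"
      by (rule finite_subset[OF _ F(1)]) auto
    moreover have "\<forall>j \<in> J. openin (discrete_topology (C j)) (?W j)" using xP by auto
    moreover have "x \<in> PiE J ?W" using xP by (auto simp: PiE_iff)
    moreover have "PiE J ?W \<subseteq> U"
    proof
      fix y assume y: "y \<in> PiE J ?W"
      have "y j \<in> C j" if "j \<in> J" for j
        using PiE_mem[OF y that] PiE_mem[OF xP that] by (auto split: if_splits)
      then have "y \<in> PiE J C" using y by (auto simp: PiE_iff)
      moreover have "y j = x j" if "j \<in> F" for j
        using PiE_mem[OF y, of j] that F(2) assms(2) by auto
      ultimately show "y \<in> U" using F(3) by blast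
    qed
    ultimately show "\<exists>W. finite {j \<in> J. W j \<noteq> topspace (discrete_topology (C j))} \<and>
        (\<forall>j \<in> J. openin (discrete_topology (C j)) (W j)) \<and> x \<in> PiE J W \<and> PiE J W \<subseteq> U"
      by (intro exI[of _ ?W] conjI)
  qed
  moreover have "compact_space ?X"
    using assms(1) by (simp add: compact_space_product_topology compact_space_discrete_topology)
  ultimately show ?thesis
    unfolding compact_space_alt by simp
qed

text \<open>Closedness over the coordinates in \<open>A\<close> forces independence of all others;
  this permits rewriting the coordinates of a new index without leaving \<open>R\<close>.\<close>

lemma closedin_prod_cylinder_topology_cong:
  assumes R: "closedin (prod_topology (cylinder_topology P A) Y) R" "(x, g) \<in> R"
    and y: "y \<in> P" "\<And>j. j \<in> A \<Longrightarrow> y j = x j"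
  shows "(y, g) \<in> R"
proof (rule ccontr)
  assume "(y, g) \<notin> R"
  have sub: "R \<subseteq> P \<times> topspace Y" using closedin_subset[OF R(1)] by simp
  have "closedin (cylinder_topology P A) {x. (x, g) \<in> R}"
    using closedin_cofibre[OF R(1)] R(2) sub by blast
  then have "openin (cylinder_topology P A) (P - {x. (x, g) \<in> R})"
    unfolding closedin_def by simp
  moreover have "y \<in> P - {x. (x, g) \<in> R}" using y(1) \<open>(y, g) \<notin> R\<close> by simp
  ultimately obtain F where "F \<subseteq> A" "\<forall>z \<in> P. (\<forall>j \<in> F. z j = y j) \<longrightarrow> z \<in> P - {x. (x, g) \<in> R}"
    unfolding openin_cylinder_topology by blast
  moreover have "x \<in> P" using R(2) sub by blast
  ultimately have "x \<in> P - {x. (x, g) \<in> R}" using y(2) by (metis subsetD)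
  then show False using R(2) by simp
qed

section \<open>Small dense sets in products of finite spaces\<close>

text \<open>The Hewitt--Marczewski--Pondiczery construction: coordinates are coded by subsets of \<open>S\<close>, and
  the points of the dense set depend on the code \<open>e j\<close> only through its trace on a finite set.\<close>

lemma product_small_dense_set:
  fixes C :: "'j \<Rightarrow> 'c set" and S :: "'s set"
  assumes S: "infinite S" and J: "|J| \<le>o |Pow S|" and C: "\<And>j. j \<in> J \<Longrightarrow> finite (C j)"
  obtains D where "D \<subseteq> PiE J C" "|D| \<le>o |S|"
    "\<And>x F. x \<in> PiE J C \<Longrightarrow> finite F \<Longrightarrow> F \<subseteq> J \<Longrightarrow> \<exists>d \<in> D. \<forall>j \<in> F. d j = x j"
proof (cases "PiE J C = {}")
  case True
  then show thesis by (intro that[of "{}"]) (auto simp: card_of_empty)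
next
  case False
  then have ne: "C j \<noteq> {}" if "j \<in> J" for j using that by (auto simp: PiE_eq_empty_iff)
  obtain e where e: "inj_on e J" "e ` J \<subseteq> Pow S"
    using J unfolding card_of_ordLeq[symmetric] by blast
  let ?Fin = "{E. finite E \<and> E \<subseteq> S}"
  \<comment> \<open>\<open>l\<close> is a finite table from traces on \<open>E\<close> to positions
    in an enumeration of \<open>C j\<close>; positions instead of points keep the number of tables
    independent of the factors. The default \<open>0\<close> is arbitrary, as
    \<open>from_nat_into\<close> always lands in the nonempty \<open>C j\<close>.\<close>
  let ?d = "\<lambda>(E, l). \<lambda>j \<in> J. from_nat_into (C j) (case map_of l (e j \<inter> E) of None \<Rightarrow> 0 | Some n \<Rightarrow> n)"
  let ?D = "?d ` (?Fin \<times> lists (?Fin \<times> (UNIV :: nat set)))"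
  have Fin: "|?Fin| \<le>o |S|" by (rule card_of_finite_subsets_ordLeq[OF S])
  have card: "|?D| \<le>o |S|"
    by (intro card_of_image_ordLeq card_of_Times_ordLeq_infinite card_of_lists_ordLeq
        S Fin card_of_nat_ordLeq)
  have sub: "?D \<subseteq> PiE J C"
    using ne by (auto intro!: from_nat_into)
  have dense: "\<exists>d \<in> ?D. \<forall>j \<in> F. d j = x j" if x: "x \<in> PiE J C" and F: "finite F" "F \<subseteq> J" for x F
  proof -
    have "\<exists>s. s \<in> S \<and> (s \<in> e j) \<noteq> (s \<in> e k)" if "j \<in> F" "k \<in> F" "j \<noteq> k" for j k
    proof -
      have "e j \<noteq> e k" using e(1) that F(2) unfolding inj_on_def by blast
      moreover have "e j \<subseteq> S" "e k \<subseteq> S" using e(2) that F(2) by auto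
      ultimately show ?thesis by blast
    qed
    then obtain s where s: "\<And>j k. j \<in> F \<Longrightarrow> k \<in> F \<Longrightarrow> j \<noteq> k \<Longrightarrow> s j k \<in> S \<and> (s j k \<in> e j) \<noteq> (s j k \<in> e k)"
      by metis
    \<comment> \<open>One separating element per pair of codes: the traces on \<open>?E\<close> are
      then distinct for distinct \<open>j\<close> in \<open>F\<close>, so the table
      \<open>?l\<close> is unambiguous.\<close>
    let ?E = "(\<lambda>(j, k). s j k) ` {z \<in> F \<times> F. fst z \<noteq> snd z}"
    have E: "finite ?E" "?E \<subseteq> S" using F(1) s by auto
    have inj: "inj_on (\<lambda>j. e j \<inter> ?E) F"
    proof (rule inj_onI, rule ccontr)
      fix j k assume jk: "j \<in> F" "k \<in> F" "e j \<inter> ?E = e k \<inter> ?E" "j \<noteq> k"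
      then have "s j k \<in> ?E" by force
      then show False using s[OF jk(1,2,4)] jk(3) by blast
    qed
    obtain js where js: "set js = F" "distinct js" using finite_distinct_list[OF F(1)] by blast
    let ?l = "map (\<lambda>j. (e j \<inter> ?E, to_nat_on (C j) (x j))) js"
    have "distinct (map fst ?l)" using inj js by (simp add: distinct_map o_def comp_inj_on_iff)
    then have l: "map_of ?l (e j \<inter> ?E) = Some (to_nat_on (C j) (x j))" if "j \<in> F" for j
      using that js(1) by (intro map_of_is_SomeI) auto
    have "?l \<in> lists (?Fin \<times> UNIV)" using E by auto
    then have "?d (?E, ?l) \<in> ?D" using E by blast
    moreover have "?d (?E, ?l) j = x j" if "j \<in> F" for j
    proof -
      have j: "j \<in> J" using that F(2) by blast
      have "from_nat_into (C j) (to_nat_on (C j) (x j)) = x j"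
        using countable_finite[OF C[OF j]] PiE_mem[OF x j] by (rule from_nat_into_to_nat_on)
      then show ?thesis using j l[OF that] by simp
    qed
    ultimately show ?thesis by blast
  qed
  show thesis by (rule that[OF sub card dense])
qed

section \<open>Parametrising a compact group by a product of finite spaces\<close>

text \<open>The nets have index \<open>n + 3\<close>, one finer than the \<open>n + 2\<close> in
  \<open>coherent\<close>, so that net points approximating the same \<open>g\<close> at consecutive
  stages are coherent.\<close>

locale net_family = compact_group G T
  for G :: "('a, 'b) monoid_scheme" (structure) and T :: "'a topology" +
  fixes I :: "'i set" and V :: "'i \<Rightarrow> nat \<Rightarrow> 'a set" and C :: "'i \<Rightarrow> nat \<Rightarrow> 'a set"
  assumes nbhd_seq: "i \<in> I \<Longrightarrow> nbhd_seq (V i)"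
    and finite_net: "i \<in> I \<Longrightarrow> finite (C i n)"
    and net_subset: "i \<in> I \<Longrightarrow> C i n \<subseteq> carrier G"
    and net: "i \<in> I \<Longrightarrow> g \<in> carrier G \<Longrightarrow> \<exists>a \<in> C i n. inv a \<otimes> g \<in> V i (n + 3)"
begin

definition params :: "('i \<times> nat \<Rightarrow> 'a) set" where
  "params = (\<Pi>\<^sub>E j \<in> I \<times> UNIV. C (fst j) (snd j))"

abbreviation param_topology :: "'i set \<Rightarrow> ('i \<times> nat \<Rightarrow> 'a) topology" where
  "param_topology A \<equiv> cylinder_topology params (A \<times> UNIV)"

definition kernel :: "'i set \<Rightarrow> 'a set" where
  "kernel A = {g \<in> carrier G. \<forall>i \<in> A. \<forall>n. g \<in> V i n}"

text \<open>The prescribed part of the lift. It is only partial: the fibre is empty over a parameter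
  whose coordinates at \<open>i\<close> are not coherent.\<close>

definition tracked :: "'i \<Rightarrow> (('i \<times> nat \<Rightarrow> 'a) \<times> 'a) set" where
  "tracked i = {(x, g). x \<in> params \<and> coherent (V i) (\<lambda>n. x (i, n)) \<and> tracks (V i) (\<lambda>n. x (i, n)) g}"

text \<open>An admissible relation is the graph of a continuous surjection from the parameters onto the
  coset space of \<open>kernel A\<close>, depending on the coordinates over \<open>A\<close> only.\<close>

definition admissible :: "'i set \<Rightarrow> (('i \<times> nat \<Rightarrow> 'a) \<times> 'a) set \<Rightarrow> bool" where
  "admissible A R \<longleftrightarrow> A \<subseteq> I \<and> closedin (prod_topology (param_topology A) T) R \<and>
     coset_valued (kernel A) R \<and> (\<forall>x \<in> params. \<exists>g. (x, g) \<in> R) \<and>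
     (\<forall>g \<in> carrier G. \<exists>x \<in> params. (x, g) \<in> R)"

lemma params_carrier: "x \<in> params \<Longrightarrow> i \<in> I \<Longrightarrow> x (i, n) \<in> carrier G"
  using PiE_mem[of x "I \<times> UNIV" "\<lambda>j. C (fst j) (snd j)" "(i, n)"] net_subset[of i n]
  unfolding params_def by auto

lemma compact_param_topology: "A \<subseteq> I \<Longrightarrow> compact_space (param_topology A)"
  unfolding params_def by (rule compact_space_cylinder_topology) (auto intro: finite_net)

lemma kernel_subgroup:
  assumes "A \<subseteq> I"
  shows "subgroup (kernel A) G"
proof (rule subgroupI)
  have V: "nbhd_seq (V i)" if "i \<in> A" for i using nbhd_seq assms that by blast
  show "kernel A \<subseteq> carrier G" unfolding kernel_def by blast
  have "\<one> \<in> kernel A" unfolding kernel_def using nbhd_seqD(4)[OF V] by simp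
  then show "kernel A \<noteq> {}" by blast
  show "inv g \<in> kernel A" if "g \<in> kernel A" for g
    using that nbhd_seqD(5)[OF V] unfolding kernel_def by simp
  show "g \<otimes> h \<in> kernel A" if "g \<in> kernel A" "h \<in> kernel A" for g h
    using that nbhd_seqD(2)[OF V] unfolding kernel_def by simp
qed

lemma kernel_insert: "kernel (insert i A) = kernel A \<inter> (\<Inter>n. V i n)"
  unfolding kernel_def by auto

lemma tracked_coset:
  assumes i: "i \<in> I" and g: "(x, g) \<in> tracked i" and h: "h \<in> carrier G"
  shows "(x, h) \<in> tracked i \<longleftrightarrow> inv g \<otimes> h \<in> (\<Inter>n. V i n)"
proof -
  have "coherent (V i) (\<lambda>n. x (i, n))" "tracks (V i) (\<lambda>n. x (i, n)) g" "x \<in> params"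
    using g unfolding tracked_def by auto
  then show ?thesis
    using tracks_diff[OF nbhd_seq[OF i], of "\<lambda>n. x (i, n)" g h] params_carrier[OF _ i]
      tracks_coset[OF nbhd_seq[OF i], of "\<lambda>n. x (i, n)" g h] h
    unfolding tracked_def by auto
qed

lemma closedin_tracked:
  assumes i: "i \<in> A" "A \<subseteq> I"
  shows "closedin (prod_topology (param_topology A) T) (tracked i)"
proof -
  let ?X = "param_topology A"
  have iI: "i \<in> I" using i by blast
  have "closedin (prod_topology ?X T) {(x, g). x \<in> topspace ?X \<and> g \<in> carrier G \<and> inv (x (i, n)) \<otimes> g \<in> V i n}" for n
    by (intro closedin_locally_constant_translate nbhd_seqD(6)[OF nbhd_seq[OF iI]]
        locally_constant_cylinder_topology[of "{(i, n)}"])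
      (use i params_carrier[OF _ iI] in auto)
  moreover have "closedin (prod_topology ?X T)
      ({x \<in> params. inv (x (i, n)) \<otimes> x (i, Suc n) \<in> V i (n + 2)} \<times> carrier G)" for n
  proof -
    have "openin ?X {x \<in> topspace ?X. inv (x (i, n)) \<otimes> x (i, Suc n) \<in> - V i (n + 2)}"
      using locally_constant_cylinder_topology[of "{(i, n), (i, Suc n)}" "A \<times> UNIV" params
          "\<lambda>x. inv (x (i, n)) \<otimes> x (i, Suc n)"] i
      unfolding locally_constant_def by (auto dest: spec[of _ "- V i (n + 2)"])
    moreover have "params - {x \<in> params. inv (x (i, n)) \<otimes> x (i, Suc n) \<in> V i (n + 2)}
        = {x \<in> topspace ?X. inv (x (i, n)) \<otimes> x (i, Suc n) \<in> - V i (n + 2)}" by auto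
    ultimately have "closedin ?X {x \<in> params. inv (x (i, n)) \<otimes> x (i, Suc n) \<in> V i (n + 2)}"
      unfolding closedin_def by auto
    moreover have "closedin T (carrier G)" by (metis closedin_topspace topspace_eq_carrier)
    ultimately show ?thesis unfolding closedin_prod_Times_iff by blast
  qed
  ultimately have "closedin (prod_topology ?X T)
     ((\<Inter>n. {(x, g). x \<in> topspace ?X \<and> g \<in> carrier G \<and> inv (x (i, n)) \<otimes> g \<in> V i n}) \<inter>
      (\<Inter>n. {x \<in> params. inv (x (i, n)) \<otimes> x (i, Suc n) \<in> V i (n + 2)} \<times> carrier G))"
    by (intro closedin_Int closedin_Inter) auto
  moreover have "tracked i =
     ((\<Inter>n. {(x, g). x \<in> topspace ?X \<and> g \<in> carrier G \<and> inv (x (i, n)) \<otimes> g \<in> V i n}) \<inter>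
      (\<Inter>n. {x \<in> params. inv (x (i, n)) \<otimes> x (i, Suc n) \<in> V i (n + 2)} \<times> carrier G))"
    using params_carrier[OF _ iI] unfolding tracked_def tracks_def coherent_def by auto
  ultimately show ?thesis by simp
qed

lemma tracking_point:
  assumes i: "i \<in> I" and g: "g \<in> carrier G"
  obtains a where "\<And>n. a n \<in> C i n" "coherent (V i) a" "tracks (V i) a g"
proof -
  obtain a where a: "\<And>n. a n \<in> C i n" "\<And>n. inv (a n) \<otimes> g \<in> V i (n + 3)"
    using net[OF i g] by metis
  note V = nbhd_seq[OF i]
  have carr: "a n \<in> carrier G" for n using a(1) net_subset[OF i] by blast
  have "inv (a n) \<otimes> a (Suc n) \<in> V i (n + 2)" for n
  proof -
    have "inv (a (Suc n)) \<otimes> g \<in> V i (n + 3)"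
      using a(2)[of "Suc n"] nbhd_seq_mono[OF V, of "n + 3" "Suc n + 3"] by auto
    then have "inv (inv (a (Suc n)) \<otimes> g) \<in> V i (n + 3)" by (rule nbhd_seqD(5)[OF V])
    then have "inv (a n) \<otimes> g \<otimes> inv (inv (a (Suc n)) \<otimes> g) \<in> V i (n + 2)"
      using nbhd_seqD(2)[OF V, of _ "n + 2"] a(2)[of n] by (simp add: eval_nat_numeral)
    moreover have "inv (a n) \<otimes> g \<otimes> inv (inv (a (Suc n)) \<otimes> g) = inv (a n) \<otimes> a (Suc n)"
      using carr g by (simp add: inv_mult_group m_assoc mult_inv_mult_cancel)
    ultimately show ?thesis by simp
  qed
  then have "coherent (V i) a" using carr unfolding coherent_def by blast
  moreover have "inv (a n) \<otimes> g \<in> V i n" for n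
    using a(2)[of n] nbhd_seq_mono[OF V, of n "n + 3"] by auto
  then have "tracks (V i) a g" using g unfolding tracks_def by blast
  ultimately show thesis using that a(1) by blast
qed

text \<open>The start for Zorn's lemma: \<open>kernel {}\<close> is the whole group, so every fibre
  is the one coset. Surjectivity still needs some parameter to exist, which holds because the nets
  are nonempty.\<close>

lemma admissible_empty: "admissible {} (params \<times> carrier G)"
proof -
  have carr: "g \<in> carrier G \<Longrightarrow> \<exists>a. \<forall>i \<in> I. \<forall>n. a i n \<in> C i n" for g
  proof -
    assume "g \<in> carrier G"
    then have "\<exists>a. \<forall>n. a n \<in> C i n" if "i \<in> I" for i using net[OF that] by metis
    then show ?thesis by metis
  qed
  then obtain a where "\<forall>i \<in> I. \<forall>n. a i n \<in> C i n" using one_closed by blast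
  then have "(\<lambda>j \<in> I \<times> UNIV. a (fst j) (snd j)) \<in> params"
    unfolding params_def by auto
  moreover have "closedin (prod_topology (param_topology {}) T) (params \<times> carrier G)"
    by (metis closedin_topspace topspace_cylinder_topology topspace_eq_carrier topspace_prod_topology)
  ultimately show ?thesis
    unfolding admissible_def coset_valued_def kernel_def by auto
qed

text \<open>\<open>R \<inter> tracked i\<close> prescribes the finer cosets wherever it has points,
  and \<open>coset_selection\<close> extends it to all parameters.\<close>

lemma admissible_insert:
  assumes R: "admissible A R" and i: "i \<in> I" "i \<notin> A"
  obtains S where "admissible (insert i A) S" "S \<subseteq> R"
proof -
  let ?B = "insert i A"
  let ?X = "param_topology ?B"
  note V = nbhd_seq[OF i(1)]
  have A: "A \<subseteq> I" "?B \<subseteq> I" using R i unfolding admissible_def by auto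
  have R': "closedin (prod_topology (param_topology A) T) R" "coset_valued (kernel A) R"
    "\<And>x. x \<in> params \<Longrightarrow> \<exists>g. (x, g) \<in> R" "\<And>g. g \<in> carrier G \<Longrightarrow> \<exists>x \<in> params. (x, g) \<in> R"
    using R unfolding admissible_def by auto
  have R_closed: "closedin (prod_topology ?X T) R"
    by (rule closedin_prod_cylinder_topology_mono[OF _ R'(1)]) auto
  have kernels: "subgroup (kernel A \<inter> (\<Inter>n. V i n)) G"
    using kernel_subgroup[OF A(2)] unfolding kernel_insert .
  have F: "closedin (prod_topology ?X T) (R \<inter> tracked i)"
    by (intro closedin_Int R_closed closedin_tracked A) simp
  have "coset_valued (kernel A \<inter> (\<Inter>n. V i n)) (R \<inter> tracked i)"
    unfolding coset_valued_def
  proof (intro allI impI)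
    fix x g h assume g: "(x, g) \<in> R \<inter> tracked i" and h: "h \<in> carrier G"
    have "(x, h) \<in> R \<longleftrightarrow> inv g \<otimes> h \<in> kernel A"
      using R'(2) g h unfolding coset_valued_def by blast
    moreover have "(x, h) \<in> tracked i \<longleftrightarrow> inv g \<otimes> h \<in> (\<Inter>n. V i n)"
      using tracked_coset[OF i(1)] g h by blast
    ultimately show "(x, h) \<in> R \<inter> tracked i \<longleftrightarrow> inv g \<otimes> h \<in> kernel A \<inter> (\<Inter>n. V i n)" by blast
  qed
  then obtain S where S: "closedin (prod_topology ?X T) S" "coset_valued (kernel A \<inter> (\<Inter>n. V i n)) S"
    "\<And>x. x \<in> params \<Longrightarrow> \<exists>g. (x, g) \<in> S" "R \<inter> tracked i \<subseteq> S" "S \<subseteq> R"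
    using coset_selection[OF compact_param_topology[OF A(2)] zero_dimensional_cylinder_topology V refl
        kernel_subgroup[OF A(1)] kernels R_closed R'(2) _ F] R'(3)
    by (metis inf_le1 topspace_cylinder_topology)
  have "\<exists>x \<in> params. (x, g) \<in> S" if g: "g \<in> carrier G" for g
  proof -
    obtain x where x: "x \<in> params" "(x, g) \<in> R" using R'(4)[OF g] by blast
    obtain a where a: "\<And>n. a n \<in> C i n" "coherent (V i) a" "tracks (V i) a g"
      using tracking_point[OF i(1) g] by blast
    \<comment> \<open>\<open>R\<close> does not see the coordinates at \<open>i\<close>, so they may
      be overwritten by a sequence tracking \<open>g\<close>: the pair stays in \<open>R\<close> and
      enters \<open>tracked i\<close>, hence \<open>S\<close>.\<close>
    let ?y = "\<lambda>j. if fst j = i then a (snd j) else x j"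
    have y: "?y \<in> params"
      using x(1) a(1) i(1) unfolding params_def by (auto simp: PiE_iff extensional_def)
    have "(?y, g) \<in> R"
      by (rule closedin_prod_cylinder_topology_cong[OF R'(1) x(2) y]) (use i(2) in auto)
    moreover have "(?y, g) \<in> tracked i"
      using y a(2,3) unfolding tracked_def by simp
    ultimately show ?thesis using S(4) y by blast
  qed
  then have "admissible ?B S"
    unfolding admissible_def using A(2) S(1-3) kernel_insert by simp
  then show thesis using S(5) that by blast
qed

text \<open>Compactness is used twice: in \<open>T\<close> for a common point of the fibres over a
  parameter, and in the parameter space for a common parameter over \<open>g\<close>.\<close>

lemma admissible_chain:
  assumes adm: "\<And>A R. (A, R) \<in> \<C> \<Longrightarrow> admissible A R" and ne: "\<C> \<noteq> {}"
    and chain: "\<And>A R A' R'. (A, R) \<in> \<C> \<Longrightarrow> (A', R') \<in> \<C> \<Longrightarrow> R \<subseteq> R' \<or> R' \<subseteq> R"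
  shows "admissible (\<Union>(fst ` \<C>)) (\<Inter>(snd ` \<C>))"
proof -
  let ?A = "\<Union>(fst ` \<C>)"
  let ?R = "\<Inter>(snd ` \<C>)"
  have A: "?A \<subseteq> I" using adm unfolding admissible_def by fastforce
  have closed: "closedin (prod_topology (param_topology ?A) T) R" if "(A, R) \<in> \<C>" for A R
  proof (rule closedin_prod_cylinder_topology_mono)
    show "A \<times> UNIV \<subseteq> ?A \<times> UNIV" using that by force
    show "closedin (prod_topology (param_topology A) T) R"
      using adm[OF that] unfolding admissible_def by blast
  qed
  then have "closedin (prod_topology (param_topology ?A) T) ?R"
    using ne by (intro closedin_Inter) auto
  moreover have "coset_valued (kernel ?A) ?R"
    unfolding coset_valued_def
  proof (intro allI impI)
    fix x g h assume g: "(x, g) \<in> ?R" and h: "h \<in> carrier G"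
    have eq: "(x, h) \<in> R \<longleftrightarrow> inv g \<otimes> h \<in> kernel A" if "(A, R) \<in> \<C>" for A R
    proof -
      have "(x, g) \<in> R" using g that by force
      then show ?thesis using adm[OF that] h unfolding admissible_def coset_valued_def by blast
    qed
    have "(x, h) \<in> ?R \<longleftrightarrow> (\<forall>(A, R) \<in> \<C>. inv g \<otimes> h \<in> kernel A)" using eq by fastforce
    also have "\<dots> \<longleftrightarrow> inv g \<otimes> h \<in> kernel ?A" using ne unfolding kernel_def by fastforce
    finally show "(x, h) \<in> ?R \<longleftrightarrow> inv g \<otimes> h \<in> kernel ?A" .
  qed
  moreover have "\<exists>g. (x, g) \<in> ?R" if x: "x \<in> params" for x
  proof -
    have "\<Inter>((\<lambda>z. snd z `` {x}) ` \<C>) \<noteq> {}"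
    proof (rule compact_space_imp_chain_Inter[OF compact])
      show "closedin T K" if "K \<in> (\<lambda>z. snd z `` {x}) ` \<C>" for K
        using that closedin_fibre[OF closed] x by auto
      show "{} \<notin> (\<lambda>z. snd z `` {x}) ` \<C>"
        using adm x unfolding admissible_def by fastforce
      show "K \<subseteq> K' \<or> K' \<subseteq> K" if "K \<in> (\<lambda>z. snd z `` {x}) ` \<C>" "K' \<in> (\<lambda>z. snd z `` {x}) ` \<C>" for K K'
        using that chain by fastforce
    qed
    then show ?thesis by auto
  qed
  moreover have "\<exists>x \<in> params. (x, g) \<in> ?R" if g: "g \<in> carrier G" for g
  proof -
    have "\<Inter>((\<lambda>z. {x. (x, g) \<in> snd z}) ` \<C>) \<noteq> {}"
    proof (rule compact_space_imp_chain_Inter[OF compact_param_topology[OF A]])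
      show "closedin (param_topology ?A) K" if "K \<in> (\<lambda>z. {x. (x, g) \<in> snd z}) ` \<C>" for K
        using that closedin_cofibre[OF closed] g topspace_eq_carrier by auto
      show "{} \<notin> (\<lambda>z. {x. (x, g) \<in> snd z}) ` \<C>"
        using adm g unfolding admissible_def by fastforce
      show "K \<subseteq> K' \<or> K' \<subseteq> K"
        if "K \<in> (\<lambda>z. {x. (x, g) \<in> snd z}) ` \<C>" "K' \<in> (\<lambda>z. {x. (x, g) \<in> snd z}) ` \<C>" for K K'
        using that chain by fastforce
    qed
    then obtain x where x: "(x, g) \<in> ?R" by auto
    obtain A R where AR: "(A, R) \<in> \<C>" using ne by fast
    then have "(x, g) \<in> R" using x by force
    then have "x \<in> params" using closedin_subset[OF closed[OF AR]] by auto
    with x show ?thesis by blast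
  qed
  ultimately show ?thesis unfolding admissible_def using A by blast
qed

lemma admissible_full: "\<exists>R. admissible I R"
proof -
  let ?Z = "{(A, R). admissible A R}"
  \<comment> \<open>Going up means more subgroups and a smaller relation, that is, finer
    cosets.\<close>
  let ?le = "\<lambda>(A, R) (A', R'). A \<subseteq> A' \<and> R' \<subseteq> R"
  have "\<exists>m \<in> ?Z. \<forall>z \<in> ?Z. ?le m z \<longrightarrow> z = m"
  proof (rule predicate_Zorn)
    show "partial_order_on ?Z (relation_of ?le ?Z)"
      by (rule partial_order_on_relation_ofI) auto
    fix \<C> assume \<C>: "\<C> \<in> Chains (relation_of ?le ?Z)"
    show "\<exists>u \<in> ?Z. \<forall>z \<in> \<C>. ?le z u"
    proof (cases "\<C> = {}")
      case True
      then show ?thesis using admissible_empty by blast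
    next
      case False
      have adm: "admissible A R" if "(A, R) \<in> \<C>" for A R
        using \<C> that unfolding Chains_def relation_of_def by fastforce
      have "R \<subseteq> R' \<or> R' \<subseteq> R" if "(A, R) \<in> \<C>" "(A', R') \<in> \<C>" for A R A' R'
        using \<C> that unfolding Chains_def relation_of_def by fastforce
      from admissible_chain[OF adm False this]
      show ?thesis by (intro bexI[of _ "(\<Union>(fst ` \<C>), \<Inter>(snd ` \<C>))"]) force+
    qed
  qed
  then obtain m where m: "m \<in> ?Z" "\<forall>z \<in> ?Z. ?le m z \<longrightarrow> z = m" ..
  obtain A R where mAR: "m = (A, R)" by (cases m)
  have AR: "admissible A R" using m(1) mAR by simp
  have max: "A' = A" if "admissible A' R'" "A \<subseteq> A'" "R' \<subseteq> R" for A' R'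
    using m(2)[THEN bspec, of "(A', R')"] that mAR by simp
  have "A = I"
  proof (rule ccontr)
    assume "A \<noteq> I"
    then obtain i where i: "i \<in> I" "i \<notin> A" using AR unfolding admissible_def by blast
    obtain S where "admissible (insert i A) S" "S \<subseteq> R" by (rule admissible_insert[OF AR i])
    then show False using max i(2) by blast
  qed
  then show ?thesis using AR by blast
qed

text \<open>With trivial kernel the fibres are points, so \<open>R\<close> is the graph of a map
  onto the group; upper semicontinuity of the fibres is its continuity, and it carries dense sets to
  dense sets.\<close>

lemma small_dense_set:
  fixes S :: "'s set"
  assumes S: "infinite S" and card: "|I \<times> (UNIV :: nat set)| \<le>o |Pow S|" and kernel: "kernel I = {\<one>}"
  obtains D where "D \<subseteq> carrier G" "T closure_of D = topspace T" "|D| \<le>o |S|"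
proof -
  obtain R where "admissible I R" using admissible_full by blast
  then have R: "closedin (prod_topology (param_topology I) T) R" "coset_valued {\<one>} R"
    "\<And>x. x \<in> params \<Longrightarrow> \<exists>g. (x, g) \<in> R" "\<And>g. g \<in> carrier G \<Longrightarrow> \<exists>x \<in> params. (x, g) \<in> R"
    unfolding admissible_def kernel by auto
  have R_carr: "R \<subseteq> params \<times> carrier G" using closedin_subset_carrier[OF R(1)] by simp
  have unique: "g = h" if "(x, g) \<in> R" "(x, h) \<in> R" for x g h
  proof -
    have carr: "g \<in> carrier G" "h \<in> carrier G" using that R_carr by auto
    have "inv g \<otimes> h = \<one>" using R(2) that carr unfolding coset_valued_def by blast
    then show ?thesis using carr by (metis inv_closed inv_equality inv_inv)
  qed
  obtain D where D: "D \<subseteq> params" "|D| \<le>o |S|"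
    "\<And>x F. x \<in> params \<Longrightarrow> finite F \<Longrightarrow> F \<subseteq> I \<times> UNIV \<Longrightarrow> \<exists>d \<in> D. \<forall>j \<in> F. d j = x j"
    unfolding params_def
    by (rule product_small_dense_set[OF S card, of "\<lambda>j. C (fst j) (snd j)"])
      (use finite_net in auto)
  obtain f where f: "\<And>x. x \<in> params \<Longrightarrow> (x, f x) \<in> R" using R(3) by metis
  show thesis
  proof (rule that[of "f ` D"])
    show "f ` D \<subseteq> carrier G" using f D(1) R_carr by auto
    show "|f ` D| \<le>o |S|" by (rule card_of_image_ordLeq[OF D(2)])
    show "T closure_of (f ` D) = topspace T"
      unfolding dense_intersects_open
    proof (intro allI impI, elim conjE)
      fix W assume W: "openin T W" "W \<noteq> {}"
      then obtain g where g: "g \<in> W" "g \<in> carrier G" using openin_subset topspace_eq_carrier by blast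
      then obtain x where x: "x \<in> params" "(x, g) \<in> R" using R(4) by blast
      let ?U = "{x \<in> params. R `` {x} \<subseteq> W}"
      have "openin (param_topology I) ?U"
        using openin_fibre_subset[OF compact R(1) W(1)] by simp
      moreover have "x \<in> ?U" using x g(1) unique by blast
      ultimately obtain F where F: "finite F" "F \<subseteq> I \<times> UNIV"
        "\<forall>y \<in> params. (\<forall>j \<in> F. y j = x j) \<longrightarrow> y \<in> ?U"
        unfolding openin_cylinder_topology by blast
      obtain d where d: "d \<in> D" "\<forall>j \<in> F. d j = x j" using D(3)[OF x(1) F(1,2)] ..
      have "d \<in> params" using d(1) D(1) by blast
      then have "d \<in> ?U" using F(3) d(2) by simp
      then have "f d \<in> W" using f[OF \<open>d \<in> params\<close>] by blast
      then show "f ` D \<inter> W \<noteq> {}" using d(1) by blast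
    qed
  qed
qed

end

section \<open>Weights of dense subspaces\<close>

lemma ordLeq_weightI: "base_of X \<B> \<Longrightarrow> |\<B>| \<le>o r \<Longrightarrow> weight X \<le>o r"
  using weight_le ordLeq_transitive by blast

lemma weight_base:
  obtains \<B> where "base_of X \<B>" "weight X = |\<B>|"
  using weight_attained[of X] by blast

lemma weight_subtopology_le: "weight (subtopology X H) \<le>o weight X"
proof -
  obtain \<B> where \<B>: "base_of X \<B>" "weight X = |\<B>|" by (rule weight_base)
  have "base_of (subtopology X H) ((\<lambda>V. V \<inter> H) ` \<B>)"
    unfolding base_of_def
  proof (intro conjI ballI allI impI)
    show "openin (subtopology X H) V" if "V \<in> (\<lambda>V. V \<inter> H) ` \<B>" for V
      using that \<B>(1) unfolding base_of_def openin_subtopology by blast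
    fix U x assume "openin (subtopology X H) U \<and> x \<in> U"
    then obtain W where W: "openin X W" "U = W \<inter> H" "x \<in> W" "x \<in> H"
      unfolding openin_subtopology by blast
    then obtain V where "V \<in> \<B>" "x \<in> V" "V \<subseteq> W" using \<B>(1) unfolding base_of_def by meson
    then show "\<exists>V \<in> (\<lambda>V. V \<inter> H) ` \<B>. x \<in> V \<and> V \<subseteq> U"
      using W(2,4) by (intro bexI[of _ "V \<inter> H"]) auto
  qed
  then show ?thesis using ordLeq_weightI[OF _ card_of_image] \<B>(2) by simp
qed

lemma dense_closure_of_openin_Int:
  assumes "X closure_of H = topspace X" "openin X U"
  shows "U \<subseteq> X closure_of (U \<inter> H)"
proof
  fix x assume x: "x \<in> U"
  have "\<exists>y. y \<in> U \<inter> H \<and> y \<in> W" if "x \<in> W" "openin X W" for W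
  proof -
    have "openin X (U \<inter> W)" "U \<inter> W \<noteq> {}" using that x assms(2) by auto
    then show ?thesis using assms(1) unfolding dense_intersects_open by blast
  qed
  then show "x \<in> X closure_of (U \<inter> H)"
    unfolding in_closure_of using x openin_subset[OF assms(2)] by blast
qed

context compact_group
begin

text \<open>Regularity puts a closed \<open>K\<close> between \<open>W\<close> and \<open>U\<close>,
  which confines the closure of the trace of \<open>W\<close>. The clause for smaller
  \<open>W'\<close> serves \<open>weight_le_dense_subgroup\<close>, where a base of \<open>H\<close>
  supplies only some trace inside \<open>W \<inter> H\<close>.\<close>

lemma interior_closure_trace:
  assumes dense: "T closure_of H = topspace T" and U: "openin T U" "x \<in> U"
  obtains W where "openin T W" "x \<in> W"
    "\<And>W'. openin T W' \<Longrightarrow> W' \<subseteq> W \<Longrightarrow> W' \<subseteq> T interior_of (T closure_of (W' \<inter> H))"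
    "T interior_of (T closure_of (W \<inter> H)) \<subseteq> U"
proof -
  obtain W K where W: "openin T W" "closedin T K" "x \<in> W" "W \<subseteq> K" "K \<subseteq> U"
    by (rule regularE[OF U])
  show thesis
  proof (rule that[OF W(1,3)])
    show "W' \<subseteq> T interior_of (T closure_of (W' \<inter> H))" if "openin T W'" for W'
      using dense_closure_of_openin_Int[OF dense that] that by (rule interior_of_maximal)
    have "T closure_of (W \<inter> H) \<subseteq> K" using W(2,4) by (intro closure_of_minimal) auto
    then show "T interior_of (T closure_of (W \<inter> H)) \<subseteq> U"
      by (rule order_trans[OF interior_of_subset order_trans[OF _ W(5)]])
  qed
qed

lemma weight_le_Pow_dense:
  assumes dense: "T closure_of H = topspace T"
  shows "weight T \<le>o |Pow H|"
proof -
  let ?\<B> = "(\<lambda>A. T interior_of (T closure_of A)) ` Pow H"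
  have "base_of T ?\<B>"
    unfolding base_of_def
  proof (intro conjI ballI allI impI)
    show "openin T V" if "V \<in> ?\<B>" for V using that by auto
    fix U x assume "openin T U \<and> x \<in> U"
    then obtain W where W: "openin T W" "x \<in> W"
      "W \<subseteq> T interior_of (T closure_of (W \<inter> H))" "T interior_of (T closure_of (W \<inter> H)) \<subseteq> U"
      using interior_closure_trace[OF dense] by (metis subset_refl)
    then show "\<exists>V \<in> ?\<B>. x \<in> V \<and> V \<subseteq> U"
      by (intro bexI[of _ "T interior_of (T closure_of (W \<inter> H))"]) auto
  qed
  then show ?thesis by (rule ordLeq_weightI[OF _ card_of_image])
qed

lemma weight_le_dense_subgroup:
  fixes S :: "'s set"
  assumes S: "infinite S" and H: "dense_subgroup H G T"
    and cards: "|H| \<le>o |S|" "weight (subtopology T H) \<le>o |S|"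
  shows "weight T \<le>o |S|"
proof -
  have sub: "subgroup H G" and dense: "T closure_of H = topspace T"
    using H unfolding dense_subgroup_def by auto
  note HG = subgroup.subset[OF sub]
  obtain \<B> where \<B>: "base_of (subtopology T H) \<B>" "weight (subtopology T H) = |\<B>|"
    by (rule weight_base)
  let ?int = "\<lambda>V. T interior_of (T closure_of V)"
  let ?\<U> = "(\<lambda>(h, V). {x \<in> carrier G. inv h \<otimes> x \<in> ?int V}) ` (H \<times> \<B>)"
  have "base_of T ?\<U>"
    unfolding base_of_def
  proof (intro conjI ballI allI impI)
    show "openin T W" if "W \<in> ?\<U>" for W
      using that HG by (auto intro!: openin_left_translate)
    fix U g assume U: "openin T U \<and> g \<in> U"
    then have g: "g \<in> carrier G" using openin_subset topspace_eq_carrier by blast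
    let ?U = "{x \<in> carrier G. g \<otimes> x \<in> U}"
    have "openin T ?U" using openin_left_translate[of U "inv g"] U g by simp
    moreover have "\<one> \<in> ?U" using U g by simp
    \<comment> \<open>Once \<open>inv h \<otimes> g\<close> lies in the symmetric set
      \<open>N\<close>, every \<open>x\<close> with \<open>inv h \<otimes> x\<close> in
      \<open>N\<close> has \<open>inv g \<otimes> x\<close> in \<open>N N\<close>, which keeps
      \<open>x\<close> in \<open>U\<close>.\<close>
    ultimately obtain N where N: "sym_nbhd N" "N \<subseteq> ?U" "\<forall>x \<in> N. \<forall>y \<in> N. x \<otimes> y \<in> ?U"
      by (rule sym_nbhd_square_subset)
    then obtain O' where O': "openin T O'" "\<one> \<in> O'" "O' \<subseteq> N" unfolding sym_nbhd_def by blast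
    obtain W where W: "openin T W" "\<one> \<in> W"
      "\<And>W'. openin T W' \<Longrightarrow> W' \<subseteq> W \<Longrightarrow> W' \<subseteq> ?int (W' \<inter> H)" "?int (W \<inter> H) \<subseteq> O'"
      using interior_closure_trace[OF dense O'(1,2)] by blast
    have "openin (subtopology T H) (W \<inter> H)" "\<one> \<in> W \<inter> H"
      using W(1,2) subgroup.one_closed[OF sub] unfolding openin_subtopology by blast+
    then obtain V where V: "V \<in> \<B>" "\<one> \<in> V" "V \<subseteq> W \<inter> H" using \<B>(1) unfolding base_of_def by meson
    have "openin (subtopology T H) V" using V(1) \<B>(1) unfolding base_of_def by blast
    then obtain V' where V': "openin T V'" "V = V' \<inter> H" unfolding openin_subtopology by blast
    \<comment> \<open>Intersecting with \<open>W\<close> leaves the trace unchanged and makes the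
      clause for open subsets of \<open>W\<close> applicable.\<close>
    have "V = (V' \<inter> W) \<inter> H" using V(3) V'(2) by blast
    then have "V' \<inter> W \<subseteq> ?int V" using W(3)[of "V' \<inter> W"] V'(1) W(1) by auto
    then have one: "\<one> \<in> ?int V" using V(2) V'(2) W(2) by blast
    have int_N: "?int V \<subseteq> N"
      using V(3) W(4) O'(3) by (meson closure_of_mono interior_of_mono order_trans)
    \<comment> \<open>Density of \<open>H\<close> is applied to this neighbourhood of
      \<open>g\<close>: only translates by elements of \<open>H\<close> keep the base small.\<close>
    have "openin T {x \<in> carrier G. inv x \<otimes> g \<in> ?int V}"
    proof -
      have "continuous_map T T (\<lambda>x. inv x \<otimes> g)"
        using g by (intro continuous_map_mult continuous_inv) (simp add: topspace_eq_carrier)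
      from openin_continuous_map_preimage[OF this openin_interior_of]
      show ?thesis by (simp add: topspace_eq_carrier)
    qed
    moreover have "g \<in> {x \<in> carrier G. inv x \<otimes> g \<in> ?int V}" using g one by simp
    ultimately obtain h where h: "h \<in> H" "h \<in> carrier G" "inv h \<otimes> g \<in> ?int V"
      using dense unfolding dense_intersects_open by blast
    have "x \<in> U" if x: "x \<in> carrier G" "inv h \<otimes> x \<in> ?int V" for x
    proof -
      have "inv (inv h \<otimes> g) \<in> N" "inv h \<otimes> x \<in> N"
        using N(1) int_N h(3) x(2) unfolding sym_nbhd_def by blast+
      then have "g \<otimes> (inv (inv h \<otimes> g) \<otimes> (inv h \<otimes> x)) \<in> U" using N(3) by blast
      moreover have "g \<otimes> (inv (inv h \<otimes> g) \<otimes> (inv h \<otimes> x)) = x"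
        using g h(2) x(1) by (simp add: inv_mult_group m_assoc mult_inv_mult_cancel)
      ultimately show ?thesis by simp
    qed
    then show "\<exists>W \<in> ?\<U>. g \<in> W \<and> W \<subseteq> U"
      using h V(1) g by (intro bexI[of _ "{x \<in> carrier G. inv h \<otimes> x \<in> ?int V}"]) auto
  qed
  moreover have "|?\<U>| \<le>o |S|"
    using cards \<B>(2) by (intro card_of_image_ordLeq card_of_Times_ordLeq_infinite S) auto
  ultimately show ?thesis by (rule ordLeq_weightI)
qed

text \<open>In a Hausdorff space a point is determined by the base members containing it, so a
  finite base would allow only finitely many points.\<close>

lemma infinite_base:
  assumes "infinite (carrier G)" "base_of T \<B>"
  shows "infinite \<B>"
proof
  assume fin: "finite \<B>"
  have "inj_on (\<lambda>x. {V \<in> \<B>. x \<in> V}) (carrier G)"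
  proof (rule inj_onI, rule ccontr)
    fix x y assume xy: "x \<in> carrier G" "y \<in> carrier G" "{V \<in> \<B>. x \<in> V} = {V \<in> \<B>. y \<in> V}" "x \<noteq> y"
    then obtain U W where "openin T U" "x \<in> U" "y \<in> W" "disjnt U W"
      using Hausdorff unfolding Hausdorff_space_def topspace_eq_carrier by meson
    then have U: "openin T U" "x \<in> U" "y \<notin> U" by (auto simp: disjnt_def)
    then obtain V where "V \<in> \<B>" "x \<in> V" "V \<subseteq> U" using assms(2) unfolding base_of_def by meson
    then show False using U(3) xy(3) by blast
  qed
  moreover have "finite ((\<lambda>x. {V \<in> \<B>. x \<in> V}) ` carrier G)"
    by (rule finite_subset[of _ "Pow \<B>"]) (use fin in auto)
  ultimately show False using assms(1) finite_imageD by blast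
qed

end

section \<open>Small dense subsets of the group and the two implications\<close>

context compact_group
begin

lemma finite_net_exists:
  assumes "sym_nbhd V"
  shows "\<exists>C. finite C \<and> C \<subseteq> carrier G \<and> (\<forall>g \<in> carrier G. \<exists>a \<in> C. inv a \<otimes> g \<in> V)"
proof -
  obtain W where W: "openin T W" "\<one> \<in> W" "W \<subseteq> V" using assms unfolding sym_nbhd_def by blast
  let ?U = "\<lambda>a. {x \<in> carrier G. inv a \<otimes> x \<in> W}"
  have "\<forall>U \<in> ?U ` carrier G. openin T U" using openin_left_translate[OF W(1)] by blast
  moreover have "topspace T \<subseteq> \<Union>(?U ` carrier G)" using W(2) by (force simp: topspace_eq_carrier)
  ultimately obtain \<F> where \<F>: "finite \<F>" "\<F> \<subseteq> ?U ` carrier G" "topspace T \<subseteq> \<Union>\<F>"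
    using compact[unfolded compact_space_alt, THEN spec, of "?U ` carrier G"] by blast
  obtain C where "C \<subseteq> carrier G" "finite C" "\<F> = ?U ` C"
    using finite_subset_image[OF \<F>(1,2)] by blast
  then show ?thesis
    using \<F>(3) W(3) by (intro exI[of _ C]) (force simp: topspace_eq_carrier)
qed

text \<open>The index set consists of the base members containing the identity: each contains its
  own subgroup, so by the Hausdorff property the subgroups meet trivially, while countably many
  coordinates for each still fit into \<open>|Pow S|\<close>.\<close>

lemma small_dense_set_exists:
  fixes S :: "'s set"
  assumes S: "infinite S" and weight: "weight T \<le>o |Pow S|"
  obtains D where "D \<subseteq> carrier G" "T closure_of D = topspace T" "|D| \<le>o |S|"
proof -
  obtain \<B> where \<B>: "base_of T \<B>" "weight T = |\<B>|" by (rule weight_base)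
  let ?I = "{U \<in> \<B>. \<one> \<in> U}"
  have "\<exists>V. nbhd_seq V \<and> V 0 \<subseteq> U" if U: "U \<in> ?I" for U
  proof -
    have "openin T U" "\<one> \<in> U" using U \<B>(1) unfolding base_of_def by auto
    then obtain V where "nbhd_seq V" "V 0 \<subseteq> U" by (rule nbhd_seq_exists)
    then show ?thesis by blast
  qed
  then obtain V where V: "\<And>U. U \<in> ?I \<Longrightarrow> nbhd_seq (V U)" "\<And>U. U \<in> ?I \<Longrightarrow> V U 0 \<subseteq> U"
    by metis
  let ?net = "\<lambda>U n C. finite C \<and> C \<subseteq> carrier G \<and> (\<forall>g \<in> carrier G. \<exists>a \<in> C. inv a \<otimes> g \<in> V U (n + 3))"
  define C where "C U n = (SOME C. ?net U n C)" for U n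
  have C: "?net U n (C U n)" if "U \<in> ?I" for U n
    unfolding C_def by (rule someI_ex[OF finite_net_exists[OF nbhd_seqD(1)[OF V(1)[OF that]]]])
  interpret net_family G T ?I V C
    using C V(1) by unfold_locales simp_all
  have "g = \<one>" if g: "g \<in> kernel ?I" for g
  proof (rule ccontr)
    assume "g \<noteq> \<one>"
    moreover have "g \<in> carrier G" using g unfolding kernel_def by blast
    ultimately obtain U W where UW: "openin T U" "openin T W" "\<one> \<in> U" "g \<in> W" "disjnt U W"
      using Hausdorff unfolding Hausdorff_space_def topspace_eq_carrier by (metis one_closed)
    then obtain B where "B \<in> \<B>" "\<one> \<in> B" "B \<subseteq> U" using \<B>(1) unfolding base_of_def by meson
    then have "g \<in> U" using g V(2)[of B] unfolding kernel_def by blast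
    then show False using UW(4,5) unfolding disjnt_def by blast
  qed
  moreover have "\<one> \<in> kernel ?I" by (rule subgroup.one_closed[OF kernel_subgroup]) simp
  ultimately have kernel: "kernel ?I = {\<one>}" by blast
  have inf: "infinite (Pow S)" using S by simp
  have "|?I| \<le>o |\<B>|" by (rule card_of_mono1) blast
  then have "|?I| \<le>o |Pow S|" using weight[unfolded \<B>(2)] by (rule ordLeq_transitive)
  then have "|?I \<times> (UNIV :: nat set)| \<le>o |Pow S|"
    by (intro card_of_Times_ordLeq_infinite inf card_of_nat_ordLeq)
  then show thesis by (rule small_dense_set[OF S _ kernel that])
qed

lemma card_dense_subgroup_ge:
  assumes "strong_limit (weight T)" "dense_subgroup H G T"
  shows "weight T \<le>o |H|"
proof (rule ccontr)
  assume "\<not> weight T \<le>o |H|"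
  then have "|H| <o weight T"
    by (rule iffD1[OF not_ordLeq_iff_ordLess[OF card_of_Well_order card_order_on_well_order_on[OF Card_order_weight]]])
  then have "ctwo ^c |H| <o weight T"
    by (rule strong_limitD[OF assms(1) card_of_Card_order])
  moreover have "|Pow H| =o ctwo ^c |H|"
    unfolding ctwo_def cexp_def Field_card_of by (rule card_of_Pow_Func)
  ultimately have "|Pow H| <o weight T" by (rule ordIso_ordLess_trans[rotated])
  moreover have "weight T \<le>o |Pow H|"
    using assms(2) unfolding dense_subgroup_def by (intro weight_le_Pow_dense) blast
  ultimately show False using not_ordLess_ordLeq by blast
qed

lemma strong_limit_weight:
  assumes inf: "infinite (carrier G)"
    and Arhangelskii: "\<And>H. dense_subgroup H G T \<Longrightarrow> Arhangelskii (subtopology T H)"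
  shows "strong_limit (weight T)"
proof (rule ccontr)
  assume "\<not> strong_limit (weight T)"
  then obtain s :: "'a set rel" where s: "Card_order s" "s <o weight T" "\<not> ctwo ^c s <o weight T"
    unfolding strong_limit_def using Card_order_weight by blast
  let ?S = "Field s"
  have S: "|?S| =o s" by (rule card_of_Field_ordIso[OF s(1)])
  have "weight T \<le>o ctwo ^c s"
    by (rule iffD1[OF not_ordLess_iff_ordLeq[OF card_order_on_well_order_on[OF Card_order_weight]
          card_order_on_well_order_on[OF Card_order_cexp]] s(3)])
  moreover have "ctwo ^c s =o |Pow ?S|"
    unfolding ctwo_def cexp_def Field_card_of by (rule ordIso_symmetric[OF card_of_Pow_Func])
  ultimately have Pow: "weight T \<le>o |Pow ?S|" by (rule ordLeq_ordIso_trans)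
  obtain \<B> where \<B>: "base_of T \<B>" "weight T = |\<B>|" by (rule weight_base)
  \<comment> \<open>The weight of an infinite group is infinite, so \<open>s\<close> cannot be
    finite; the estimates for words and products need this.\<close>
  have "infinite (Pow ?S)"
    by (rule card_of_ordLeq_infinite[OF Pow[unfolded \<B>(2)] infinite_base[OF inf \<B>(1)]])
  then have inf_S: "infinite ?S" by simp
  obtain D where D: "D \<subseteq> carrier G" "T closure_of D = topspace T" "|D| \<le>o |?S|"
    by (rule small_dense_set_exists[OF inf_S Pow])
  let ?H = "generate G D"
  have sub: "subgroup ?H G" by (rule generate_is_subgroup[OF D(1)])
  have "T closure_of D \<subseteq> T closure_of ?H"
    by (intro closure_of_mono subsetI) (rule generate.incl)
  then have H: "dense_subgroup ?H G T"
    unfolding dense_subgroup_def using sub D(2) closure_of_subset_topspace[of T ?H] by auto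
  have card: "|?H| \<le>o |?S|" by (rule card_of_generate_ordLeq[OF inf_S D(1,3)])
  have "topspace (subtopology T ?H) = ?H"
    using subgroup.subset[OF sub] topspace_eq_carrier by auto
  then have "weight (subtopology T ?H) \<le>o |?H|"
    using Arhangelskii[OF H] unfolding Arhangelskii_def by simp
  from ordLeq_transitive[OF this card] have "weight T \<le>o |?S|"
    by (rule weight_le_dense_subgroup[OF inf_S H card])
  then have "weight T \<le>o s" using S by (rule ordLeq_ordIso_trans)
  then show False using s(2) not_ordLess_ordLeq by blast
qed

end

text \<open>A finite group is its own only dense subgroup and has its order as weight, so it
  satisfies the left side, but a nonzero finite weight is not a strong limit; hence the infinite
  carrier.\<close>

theorem theorem4p1:
  fixes G :: "('a, 'b) monoid_scheme" and T :: "'a topology"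
  assumes "compact_group G T"
    and "infinite (carrier G)"
  shows "(\<forall>H. dense_subgroup H G T \<longrightarrow> Arhangelskii (subtopology T H))
    \<longleftrightarrow> strong_limit (weight T)"
proof -
  interpret compact_group G T by (rule assms(1))
  show ?thesis
  proof (intro iffI allI impI)
    assume "\<forall>H. dense_subgroup H G T \<longrightarrow> Arhangelskii (subtopology T H)"
    then show "strong_limit (weight T)"
      by (intro strong_limit_weight[OF assms(2)]) simp
  next
    fix H assume "strong_limit (weight T)" and H: "dense_subgroup H G T"
    then have "weight (subtopology T H) \<le>o |H|"
      using ordLeq_transitive[OF weight_subtopology_le card_dense_subgroup_ge] by blast
    moreover have "topspace (subtopology T H) = H"
      using H subgroup.subset topspace_eq_carrier unfolding dense_subgroup_def by fastforce
    ultimately show "Arhangelskii (subtopology T H)"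
      unfolding Arhangelskii_def by simp
  qed
qed

end
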